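(* Let $\alpha\in\mathbb{R}$. The statistical manifold $(\{(x,y)\in\mathbb{R}^2 : y>0\},g,\nabla^{(\alpha)})$ of the normal distributions (with $(x,y)=(\mu,\sigma)$, $g$ the Fisher metric and $\nabla^{(\alpha)}$ the Amari--Chentsov $\alpha$-connection) is identified, via $(x,y)\mapsto\begin{pmatrix}y&x\\0&1\end{pmatrix}$, with the solvable Lie group $$G=\left\{\begin{pmatrix}y&x\\0&1\end{pmatrix} : x,y\in\mathbb{R},\ y>0\right\}$$ equipped with the left-invariant metric $g=(dx^2+2\,dy^2)/y^2$ and the left-invariant connection $\nabla^{(\alpha)}$ given by $$\nabla^{(\alpha)}_{e_1}e_1=\frac{1-\alpha}{\sqrt2}e_2,\quad \nabla^{(\alpha)}_{e_1}e_2=-\frac{1+\alpha}{\sqrt2}e_1,\quad \nabla^{(\alpha)}_{e_2}e_1=-\frac{\alpha}{\sqrt2}e_1,\quad \nabla^{(\alpha)}_{e_2}e_2=-\frac{2\alpha}{\sqrt2}e_2,$$ where $\{e_1,e_2\}$ is the left-invariant orthonormal frame field described in the context. Furthermore, the skewness operator $K$ (that of $(g,\nabla^{(1)})$) is given by $$K(e_1,e_1)=\sqrt2\,e_2,\quad K(e_1,e_2)=\sqrt2\,e_1,\quad K(e_2,e_2)=2\sqrt2\,e_2.$$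
   Context: The Lie algebra of $G$ is spanned by $E_1=\begin{pmatrix}0&1\\0&0\end{pmatrix}$ and $E_2=\begin{pmatrix}1&0\\0&0\end{pmatrix}$, with $[E_1,E_2]=-E_1$. Put $e_1=E_1$ and $e_2=\frac{1}{\sqrt2}E_2$, regarded as left-invariant vector fields on $G$; in the global coordinates $(x,y)$, $e_1=y\,\partial_x$ and $e_2=\frac{y}{\sqrt2}\,\partial_y$. The Fisher metric and the Amari--Chentsov $\alpha$-connection of the space of normal distributions are defined as follows. Let $p(t,\theta)=\frac{1}{\sqrt{2\pi\sigma^2}}\exp\{-\frac{(t-\mu)^2}{2\sigma^2}\}$, $\theta=(\mu,\sigma)\in\mathbb{R}\times\mathbb{R}^+$, and $E_\theta[f]=\int_{\mathbb{R}}f(t)p(t,\theta)\,dt$. Put $g(X,Y)=E_\theta[(X\log p)(Y\log p)]$ and $C(X,Y,Z)=E_\theta[(X\log p)(Y\log p)(Z\log p)]$, and define $\nabla^{(\alpha)}$ by $g(\nabla^{(\alpha)}_XY,Z)=g(\nabla^{g}_XY,Z)-\frac{\alpha}{2}C(X,Y,Z)$, where $\nabla^g$ is the Levi-Civita connection of $g$. Explicitly, in coordinates $(x,y)=(\mu,\sigma)$, $g=(dx^2+2dy^2)/y^2$ and $$\nabla^{(\alpha)}_{\partial_x}\partial_x=\frac{1-\alpha}{2y}\partial_y,\quad \nabla^{(\alpha)}_{\partial_x}\partial_y=\nabla^{(\alpha)}_{\partial_y}\partial_x=-\frac{1+\alpha}{y}\partial_x,\quad \nabla^{(\alpha)}_{\partial_y}\partial_y=-\frac{1+2\alpha}{y}\partial_y.$$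 The skewness operator of a pair $(g,\nabla)$, where $\nabla$ is torsion-free and $\nabla g$ is totally symmetric, is the $(1,2)$-tensor field $K$ defined by $g(K(X,Y),Z)=(\nabla_Xg)(Y,Z)$. For all $\alpha$ one has the convention $\nabla^{(\alpha)}_XY=\nabla^g_XY-\frac{\alpha}{2}K(X,Y)$, with $K$ the skewness operator of $(g,\nabla^{(1)})$. *)

theory Defs
  imports "HOL-Probability.Probability" "HOL-Algebra.Solvable_Groups"
begin

section \<open>Calculus on relatively open subsets of affine subspaces\<close>

text \<open>Both manifolds involved, the upper half-plane and the group of matrices with second row
  \<open>(0, 1)\<close>, are relatively open subsets of an affine subspace of a Euclidean space.  All tangent
  spaces of such a set \<open>M\<close> are the direction space of its affine hull, and tensor fields are
  functions on \<open>M\<close> with values in the corresponding spaces.\<close>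

definition affine_domain :: "'a::euclidean_space set \<Rightarrow> bool" where
  "affine_domain M \<longleftrightarrow> M \<noteq> {} \<and> openin (top_of_set (affine hull M)) M"

definition tangent :: "'a::euclidean_space set \<Rightarrow> 'a set" where
  "tangent M = span {p - q | p q. p \<in> M \<and> q \<in> M}"

definition dird :: "('a::euclidean_space \<Rightarrow> 'b::real_normed_vector) \<Rightarrow> 'a \<Rightarrow> 'a \<Rightarrow> 'b" where
  "dird f p v = vector_derivative (\<lambda>t::real. f (p + t *\<^sub>R v)) (at 0)"

primrec Ck_on :: "nat \<Rightarrow> 'a::euclidean_space set \<Rightarrow> ('a \<Rightarrow> 'b::real_normed_vector) \<Rightarrow> bool" where
  "Ck_on 0 M f \<longleftrightarrow> continuous_on M f"
| "Ck_on (Suc k) M f \<longleftrightarrow>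
     f differentiable_on M \<and> (\<forall>v\<in>tangent M. Ck_on k M (\<lambda>p. dird f p v))"

definition smooth_on :: "'a::euclidean_space set \<Rightarrow> ('a \<Rightarrow> 'b::real_normed_vector) \<Rightarrow> bool" where
  "smooth_on M f \<longleftrightarrow> (\<forall>k. Ck_on k M f)"

text \<open>Vector fields are extended by \<open>0\<close> outside \<open>M\<close>, so that equality of vector fields on \<open>M\<close> is
  equality of functions.\<close>

definition vector_fields :: "'a::euclidean_space set \<Rightarrow> ('a \<Rightarrow> 'a) set" where
  "vector_fields M = {X. smooth_on M X \<and> (\<forall>p\<in>M. X p \<in> tangent M) \<and> (\<forall>p. p \<notin> M \<longrightarrow> X p = 0)}"

definition lie_bracket ::
    "'a::euclidean_space set \<Rightarrow> ('a \<Rightarrow> 'a) \<Rightarrow> ('a \<Rightarrow> 'a) \<Rightarrow> 'a \<Rightarrow> 'a" where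
  "lie_bracket M X Y p = (if p \<in> M then dird Y p (X p) - dird X p (Y p) else 0)"

definition diffeomorphism ::
    "('a::euclidean_space \<Rightarrow> 'b::euclidean_space) \<Rightarrow> 'a set \<Rightarrow> 'b set \<Rightarrow> bool" where
  "diffeomorphism \<phi> M N \<longleftrightarrow>
     bij_betw \<phi> M N \<and> smooth_on M \<phi> \<and> smooth_on N (inv_into M \<phi>)"

definition pushforward ::
    "('a::euclidean_space \<Rightarrow> 'b::euclidean_space) \<Rightarrow> 'a set \<Rightarrow> ('a \<Rightarrow> 'a) \<Rightarrow> 'b \<Rightarrow> 'b" where
  "pushforward \<phi> M X q =
     (if q \<in> \<phi> ` M then dird \<phi> (inv_into M \<phi> q) (X (inv_into M \<phi> q)) else 0)"

section \<open>Metrics, connections and statistical manifolds\<close>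

type_synonym 'a metric = "'a \<Rightarrow> 'a \<Rightarrow> 'a \<Rightarrow> real"
type_synonym 'a connection = "('a \<Rightarrow> 'a) \<Rightarrow> ('a \<Rightarrow> 'a) \<Rightarrow> 'a \<Rightarrow> 'a"

definition riemannian_metric :: "'a::euclidean_space set \<Rightarrow> 'a metric \<Rightarrow> bool" where
  "riemannian_metric M g \<longleftrightarrow>
     (\<forall>p\<in>M. \<forall>u\<in>tangent M. \<forall>v\<in>tangent M. \<forall>w\<in>tangent M. \<forall>c.
        g p (u + c *\<^sub>R v) w = g p u w + c * g p v w) \<and>
     (\<forall>p\<in>M. \<forall>u\<in>tangent M. \<forall>v\<in>tangent M. g p u v = g p v u) \<and>
     (\<forall>p\<in>M. \<forall>u\<in>tangent M. u \<noteq> 0 \<longrightarrow> g p u u > 0) \<and>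
     (\<forall>X\<in>vector_fields M. \<forall>Y\<in>vector_fields M. smooth_on M (\<lambda>p. g p (X p) (Y p)))"

text \<open>The last clause fixes the value of a connection on arguments that are not vector fields, so
  that a connection is uniquely determined as a function.\<close>

definition affine_connection :: "'a::euclidean_space set \<Rightarrow> 'a connection \<Rightarrow> bool" where
  "affine_connection M D \<longleftrightarrow>
     (\<forall>X\<in>vector_fields M. \<forall>Y\<in>vector_fields M. D X Y \<in> vector_fields M) \<and>
     (\<forall>X\<in>vector_fields M. \<forall>Y\<in>vector_fields M. \<forall>Z\<in>vector_fields M.
        D (\<lambda>p. X p + Y p) Z = (\<lambda>p. D X Z p + D Y Z p) \<and>
        D X (\<lambda>p. Y p + Z p) = (\<lambda>p. D X Y p + D X Z p)) \<and>
     (\<forall>X\<in>vector_fields M. \<forall>Y\<in>vector_fields M. \<forall>f::'a \<Rightarrow> real. smooth_on M f \<longrightarrow>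
        D (\<lambda>p. f p *\<^sub>R X p) Y = (\<lambda>p. f p *\<^sub>R D X Y p) \<and>
        D X (\<lambda>p. f p *\<^sub>R Y p) = (\<lambda>p. dird f p (X p) *\<^sub>R Y p + f p *\<^sub>R D X Y p)) \<and>
     (\<forall>X Y. X \<notin> vector_fields M \<or> Y \<notin> vector_fields M \<longrightarrow> D X Y = (\<lambda>p. 0))"

definition torsion_free :: "'a::euclidean_space set \<Rightarrow> 'a connection \<Rightarrow> bool" where
  "torsion_free M D \<longleftrightarrow> (\<forall>X\<in>vector_fields M. \<forall>Y\<in>vector_fields M.
     (\<lambda>p. D X Y p - D Y X p) = lie_bracket M X Y)"

text \<open>\<open>nabla_metric g D X Y Z\<close> is the function \<open>(\<nabla>\<^sub>X g)(Y, Z)\<close>.\<close>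

definition nabla_metric :: "'a::euclidean_space metric \<Rightarrow> 'a connection \<Rightarrow>
    ('a \<Rightarrow> 'a) \<Rightarrow> ('a \<Rightarrow> 'a) \<Rightarrow> ('a \<Rightarrow> 'a) \<Rightarrow> 'a \<Rightarrow> real" where
  "nabla_metric g D X Y Z p =
     dird (\<lambda>q. g q (Y q) (Z q)) p (X p) - g p (D X Y p) (Z p) - g p (Y p) (D X Z p)"

definition levi_civita :: "'a::euclidean_space set \<Rightarrow> 'a metric \<Rightarrow> 'a connection" where
  "levi_civita M g = (THE D. affine_connection M D \<and> torsion_free M D \<and>
     (\<forall>X\<in>vector_fields M. \<forall>Y\<in>vector_fields M. \<forall>Z\<in>vector_fields M. \<forall>p\<in>M.
        nabla_metric g D X Y Z p = 0))"

definition statistical_manifold ::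
    "'a::euclidean_space set \<Rightarrow> 'a metric \<Rightarrow> 'a connection \<Rightarrow> bool" where
  "statistical_manifold M g D \<longleftrightarrow>
     affine_domain M \<and> riemannian_metric M g \<and> affine_connection M D \<and> torsion_free M D \<and>
     (\<forall>X\<in>vector_fields M. \<forall>Y\<in>vector_fields M. \<forall>Z\<in>vector_fields M. \<forall>p\<in>M.
        nabla_metric g D X Y Z p = nabla_metric g D Y X Z p \<and>
        nabla_metric g D X Y Z p = nabla_metric g D X Z Y p)"

definition skewness_operator ::
    "'a::euclidean_space set \<Rightarrow> 'a metric \<Rightarrow> 'a connection \<Rightarrow> 'a connection" where
  "skewness_operator M g D X Y p = (if p \<in> M then
     (THE v. v \<in> tangent M \<and> (\<forall>Z\<in>vector_fields M. g p v (Z p) = nabla_metric g D X Y Z p))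
     else 0)"

definition metric_preserving :: "('a::euclidean_space \<Rightarrow> 'b::euclidean_space) \<Rightarrow>
    'a set \<Rightarrow> 'a metric \<Rightarrow> 'b metric \<Rightarrow> bool" where
  "metric_preserving \<phi> M g h \<longleftrightarrow> (\<forall>p\<in>M. \<forall>u\<in>tangent M. \<forall>v\<in>tangent M.
     h (\<phi> p) (dird \<phi> p u) (dird \<phi> p v) = g p u v)"

definition connection_preserving :: "('a::euclidean_space \<Rightarrow> 'b::euclidean_space) \<Rightarrow>
    'a set \<Rightarrow> 'a connection \<Rightarrow> 'b connection \<Rightarrow> bool" where
  "connection_preserving \<phi> M D E \<longleftrightarrow> (\<forall>X\<in>vector_fields M. \<forall>Y\<in>vector_fields M.
     pushforward \<phi> M (D X Y) = E (pushforward \<phi> M X) (pushforward \<phi> M Y))"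

definition statistical_isomorphism :: "('a::euclidean_space \<Rightarrow> 'b::euclidean_space) \<Rightarrow>
    'a set \<Rightarrow> 'a metric \<Rightarrow> 'a connection \<Rightarrow> 'b set \<Rightarrow> 'b metric \<Rightarrow> 'b connection \<Rightarrow> bool" where
  "statistical_isomorphism \<phi> M g D N h E \<longleftrightarrow>
     statistical_manifold M g D \<and> statistical_manifold N h E \<and> diffeomorphism \<phi> M N \<and>
     metric_preserving \<phi> M g h \<and> connection_preserving \<phi> M D E"

definition transport_connection ::
    "('a::euclidean_space \<Rightarrow> 'b::euclidean_space) \<Rightarrow> 'a set \<Rightarrow> 'a connection \<Rightarrow> 'b connection" where
  "transport_connection \<phi> M D U V =
     (if U \<in> vector_fields (\<phi> ` M) \<and> V \<in> vector_fields (\<phi> ` M)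
      then pushforward \<phi> M (D (pushforward (inv_into M \<phi>) (\<phi> ` M) U)
                              (pushforward (inv_into M \<phi>) (\<phi> ` M) V))
      else (\<lambda>q. 0))"

definition orthonormal_frame ::
    "'a::euclidean_space set \<Rightarrow> 'a metric \<Rightarrow> ('a \<Rightarrow> 'a) \<Rightarrow> ('a \<Rightarrow> 'a) \<Rightarrow> bool" where
  "orthonormal_frame M g X Y \<longleftrightarrow> X \<in> vector_fields M \<and> Y \<in> vector_fields M \<and>
     (\<forall>p\<in>M. span {X p, Y p} = tangent M \<and>
        g p (X p) (X p) = 1 \<and> g p (X p) (Y p) = 0 \<and> g p (Y p) (Y p) = 1)"

section \<open>Lie groups and left invariance\<close>

definition lie_group :: "'a::euclidean_space monoid \<Rightarrow> bool" where
  "lie_group G \<longleftrightarrow> group G \<and> affine_domain (carrier G) \<and>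
     smooth_on (carrier G \<times> carrier G) (\<lambda>(a, b). a \<otimes>\<^bsub>G\<^esub> b) \<and>
     smooth_on (carrier G) (\<lambda>a. inv\<^bsub>G\<^esub> a)"

definition left_invariant_metric :: "'a::euclidean_space monoid \<Rightarrow> 'a metric \<Rightarrow> bool" where
  "left_invariant_metric G g \<longleftrightarrow>
     (\<forall>a\<in>carrier G. metric_preserving (\<lambda>b. a \<otimes>\<^bsub>G\<^esub> b) (carrier G) g g)"

definition left_invariant_connection :: "'a::euclidean_space monoid \<Rightarrow> 'a connection \<Rightarrow> bool" where
  "left_invariant_connection G D \<longleftrightarrow>
     (\<forall>a\<in>carrier G. connection_preserving (\<lambda>b. a \<otimes>\<^bsub>G\<^esub> b) (carrier G) D D)"

definition left_invariant_field :: "'a::euclidean_space monoid \<Rightarrow> ('a \<Rightarrow> 'a) \<Rightarrow> bool" where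
  "left_invariant_field G X \<longleftrightarrow>
     (\<forall>a\<in>carrier G. pushforward (\<lambda>b. a \<otimes>\<^bsub>G\<^esub> b) (carrier G) X = X)"

text \<open>The left-invariant vector field whose value at the identity is \<open>v\<close>.\<close>

definition left_field :: "'a::euclidean_space monoid \<Rightarrow> 'a \<Rightarrow> 'a \<Rightarrow> 'a" where
  "left_field G v a = (if a \<in> carrier G then dird (\<lambda>b. a \<otimes>\<^bsub>G\<^esub> b) \<one>\<^bsub>G\<^esub> v else 0)"

section \<open>The statistical manifold of the normal distributions\<close>

text \<open>The parameter \<open>\<theta> = (x, y)\<close> is \<open>(\<mu>, \<sigma>)\<close>.\<close>

definition half_plane :: "(real \<times> real) set" where
  "half_plane = {(x, y). y > 0}"

definition expectation_at :: "real \<times> real \<Rightarrow> (real \<Rightarrow> real) \<Rightarrow> real" where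
  "expectation_at \<theta> f = (\<integral>t. f t * normal_density (fst \<theta>) (snd \<theta>) t \<partial>lborel)"

definition score :: "real \<times> real \<Rightarrow> real \<times> real \<Rightarrow> real \<Rightarrow> real" where
  "score \<theta> u t = dird (\<lambda>\<eta>. ln (normal_density (fst \<eta>) (snd \<eta>) t)) \<theta> u"

definition fisher_metric :: "(real \<times> real) metric" where
  "fisher_metric \<theta> u v = expectation_at \<theta> (\<lambda>t. score \<theta> u t * score \<theta> v t)"

definition amari_chentsov ::
    "real \<times> real \<Rightarrow> real \<times> real \<Rightarrow> real \<times> real \<Rightarrow> real \<times> real \<Rightarrow> real" where
  "amari_chentsov \<theta> u v w = expectation_at \<theta> (\<lambda>t. score \<theta> u t * score \<theta> v t * score \<theta> w t)"

definition alpha_connection :: "real \<Rightarrow> (real \<times> real) connection" where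
  "alpha_connection \<alpha> = (THE D. affine_connection half_plane D \<and>
     (\<forall>X\<in>vector_fields half_plane. \<forall>Y\<in>vector_fields half_plane. \<forall>Z\<in>vector_fields half_plane.
      \<forall>p\<in>half_plane.
        fisher_metric p (D X Y p) (Z p) =
          fisher_metric p (levi_civita half_plane fisher_metric X Y p) (Z p)
          - \<alpha> / 2 * amari_chentsov p (X p) (Y p) (Z p)))"

section \<open>The matrix group\<close>

definition to_matrix :: "real \<times> real \<Rightarrow> real^2^2" where
  "to_matrix \<theta> = vector [vector [snd \<theta>, fst \<theta>], vector [0, 1]]"

definition matrix_group :: "(real^2^2) monoid" where
  "matrix_group = \<lparr>carrier = {vector [vector [y, x], vector [0, 1]] | x y. y > 0},
     mult = (**), one = mat 1\<rparr>"

text \<open>The metric \<open>(dx\<^sup>2 + 2 dy\<^sup>2) / y\<^sup>2\<close>, where the coordinates \<open>x\<close> and \<open>y\<close> of a matrix are its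
  entries at positions \<open>(1, 2)\<close> and \<open>(1, 1)\<close>.\<close>

definition matrix_metric :: "(real^2^2) metric" where
  "matrix_metric A U V = (U $ 1 $ 2 * V $ 1 $ 2 + 2 * (U $ 1 $ 1 * V $ 1 $ 1)) / (A $ 1 $ 1)\<^sup>2"

definition matrix_connection :: "real \<Rightarrow> (real^2^2) connection" where
  "matrix_connection \<alpha> = transport_connection to_matrix half_plane (alpha_connection \<alpha>)"

definition E1 :: "real^2^2" where
  "E1 = vector [vector [0, 1], vector [0, 0]]"

definition E2 :: "real^2^2" where
  "E2 = vector [vector [1, 0], vector [0, 0]]"

definition e1 :: "real^2^2 \<Rightarrow> real^2^2" where
  "e1 = left_field matrix_group E1"

definition e2 :: "real^2^2 \<Rightarrow> real^2^2" where
  "e2 = left_field matrix_group ((1 / sqrt 2) *\<^sub>R E2)"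

end

theory Submission
  imports Defs
begin

text \<open>Both manifolds are relatively open in an affine space and carry two global linear coordinates
  \<open>x\<close>, \<open>y\<close> with \<open>y > 0\<close>, so every connection in question is the flat derivative plus explicit
  Christoffel symbols, and the isomorphism and all left translations are restrictions of affine
  maps.  The Gaussian moments up to order six give the Fisher metric and the cubic form in these
  coordinates.  For the connection with parameter \<open>\<alpha>\<close> one computes \<open>\<nabla>g = \<alpha> C\<close>; hence \<open>\<alpha> = 0\<close> is the
  Levi-Civita connection and \<open>\<alpha> = 1\<close> yields the skewness operator.\<close>

section \<open>Differential calculus on tangentially open sets\<close>

text \<open>The group is not open in the space of 2 by 2 matrices, so derivatives within it are not
  determined as linear maps on the ambient space. \<open>dird\<close> differentiates along lines
  instead, and \<open>tangentially_open\<close> makes lines usable: started at a point of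
  \<open>M\<close> in a tangent direction, a line stays in \<open>M\<close> for small times. Hence
  any derivative within \<open>M\<close> computes \<open>dird\<close>, and only values on
  \<open>M\<close> matter. Unlike a description by affine hulls, this property passes to products at
  once, which serves the group multiplication. The Levi-Civita connection, the \<alpha>-connections
  and the skewness operator are definite descriptions, so each explicit formula must be paired with
  a uniqueness argument; nondegeneracy of the metric, tested on smooth fields, is its core. The
  default value 0 turns agreement on \<open>M\<close> into equality of functions. One locale is
  instantiated twice: on the half-plane it identifies the connections built from the Fisher metric,
  on the group it yields the frame computations. The two meet because the isomorphism matches the
  Christoffel symbols.\<close>

definition tangentially_open :: "'a::euclidean_space set \<Rightarrow> bool" where
  "tangentially_open M \<longleftrightarrow> (\<forall>p\<in>M. \<forall>v\<in>tangent M. \<forall>\<^sub>F t in nhds (0::real). p + t *\<^sub>R v \<in> M)"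

lemma subspace_tangent [simp]: "subspace (tangent M)"
  by (simp add: tangent_def)

lemma diff_in_tangent: "p \<in> M \<Longrightarrow> q \<in> M \<Longrightarrow> p - q \<in> tangent M"
  unfolding tangent_def by (rule span_base) blast

text \<open>The vectors that translate \<open>S\<close> into itself form a subspace: a multiple of a
  translation is an affine combination of \<open>p\<close> and \<open>p + x\<close>. This subspace
  contains all differences of points of \<open>M\<close>, which span the tangent space.\<close>

lemma affine_translate_tangent:
  assumes "affine S" "M \<subseteq> S" "v \<in> tangent M" "p \<in> S"
  shows "p + v \<in> S"
proof -
  have "subspace {v. \<forall>p\<in>S. p + v \<in> S}"
  proof (unfold subspace_def, safe)
    fix p assume "p \<in> S" then show "p + 0 \<in> S" by simp
  next
    fix x y p assume "\<forall>p\<in>S. p + x \<in> S" "\<forall>p\<in>S. p + y \<in> S" "p \<in> S"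
    then show "p + (x + y) \<in> S" by (metis add.assoc)
  next
    fix c x p assume x: "\<forall>p\<in>S. p + x \<in> S" and "p \<in> S"
    then have "(1 - c) *\<^sub>R p + c *\<^sub>R (p + x) \<in> S"
      by (intro mem_affine[OF assms(1)]) auto
    then show "p + c *\<^sub>R x \<in> S" by (simp add: algebra_simps)
  qed
  moreover have "{p - q | p q. p \<in> M \<and> q \<in> M} \<subseteq> {v. \<forall>p\<in>S. p + v \<in> S}"
  proof safe
    fix a b p assume "a \<in> M" "b \<in> M" "p \<in> S"
    then show "p + (a - b) \<in> S"
      using mem_affine_3_minus[OF assms(1), of p a b 1] assms(2) by auto
  qed
  ultimately show ?thesis
    using assms(3,4) span_minimal unfolding tangent_def by blast
qed

lemma affine_domain_tangentially_open:
  assumes "affine_domain M" shows "tangentially_open M"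
  unfolding tangentially_open_def
proof safe
  fix p v assume p: "p \<in> M" and v: "v \<in> tangent M"
  obtain T where T: "open T" "M = affine hull M \<inter> T"
    using assms unfolding affine_domain_def openin_open by blast
  have "isCont (\<lambda>t::real. p + t *\<^sub>R v) 0" by (intro continuous_intros)
  then have "((\<lambda>t::real. p + t *\<^sub>R v) \<longlongrightarrow> p) (nhds 0)"
    using tendsto_at_iff_tendsto_nhds[of "\<lambda>t::real. p + t *\<^sub>R v" 0] by (simp add: isCont_def)
  moreover have "p \<in> T" using p T by blast
  ultimately have "\<forall>\<^sub>F t in nhds (0::real). p + t *\<^sub>R v \<in> T"
    using T(1) topological_tendstoD by blast
  moreover have "p + t *\<^sub>R v \<in> affine hull M" for t
    using p v
    by (intro affine_translate_tangent[OF affine_affine_hull hull_subset]) (auto simp: subspace_scale hull_inc)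
  ultimately show "\<forall>\<^sub>F t in nhds (0::real). p + t *\<^sub>R v \<in> M"
    by (subst T(2)) (simp add: eventually_conj_iff)
qed

lemma tangent_Times_subset: "tangent (M \<times> N) \<subseteq> tangent M \<times> tangent N"
  unfolding tangent_def[of "M \<times> N"]
  by (rule span_minimal) (auto intro: subspace_Times diff_in_tangent)

lemma tangentially_open_Times:
  assumes "tangentially_open M" "tangentially_open N"
  shows "tangentially_open (M \<times> N)"
  unfolding tangentially_open_def
proof (safe)
  fix a b v w assume "a \<in> M" "b \<in> N" "(v, w) \<in> tangent (M \<times> N)"
  then have "\<forall>\<^sub>F t in nhds (0::real). a + t *\<^sub>R v \<in> M" "\<forall>\<^sub>F t in nhds (0::real). b + t *\<^sub>R w \<in> N"
    using assms tangent_Times_subset[of M N] unfolding tangentially_open_def by blast+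
  then show "\<forall>\<^sub>F t in nhds (0::real). (a, b) + t *\<^sub>R (v, w) \<in> M \<times> N"
    by eventually_elim auto
qed

section \<open>Directional derivatives and their calculus\<close>

lemma has_vector_derivative_along_tangent:
  assumes "tangentially_open M" "p \<in> M" "v \<in> tangent M" "(f has_derivative f') (at p within M)"
  shows "((\<lambda>t. f (p + t *\<^sub>R v)) has_vector_derivative f' v) (at 0)"
proof -
  define S where "S = {t::real. p + t *\<^sub>R v \<in> M}"
  have "\<forall>\<^sub>F t in nhds (0::real). p + t *\<^sub>R v \<in> M"
    using assms unfolding tangentially_open_def by blast
  then obtain U where "open U" "0 \<in> U" "U \<subseteq> S"
    unfolding eventually_nhds S_def by blast
  then have S: "at 0 within S = at (0::real)"
    by (intro at_within_interior) (auto simp: interior_def)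
  have d: "((\<lambda>t. p + t *\<^sub>R v) has_derivative (\<lambda>t. t *\<^sub>R v)) (at 0 within S)"
    by (auto intro!: derivative_eq_intros)
  have "(f has_derivative f') (at (p + 0 *\<^sub>R v) within (\<lambda>t. p + t *\<^sub>R v) ` S)"
    using assms(4) by (auto intro: has_derivative_subset simp: S_def)
  from diff_chain_within[OF d this] have "((\<lambda>t. f (p + t *\<^sub>R v)) has_derivative (\<lambda>t. f' (t *\<^sub>R v))) (at 0)"
    by (simp add: o_def S)
  then show ?thesis
    using has_derivative_bounded_linear[OF assms(4)]
    by (simp add: has_vector_derivative_def linear_simps)
qed

text \<open>The bridge between the two notions of derivative: differentiability is meant within
  \<open>M\<close>, \<open>dird\<close> along a line. The line meets \<open>M\<close> in a set of
  times that is a neighbourhood of 0, so the chain rule within that set gives a genuine derivative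
  at 0. The calculus rules below follow from the library rules through this lemma.\<close>

lemma dird_eq:
  assumes "tangentially_open M" "p \<in> M" "v \<in> tangent M" "(f has_derivative f') (at p within M)"
  shows "dird f p v = f' v"
  unfolding dird_def
  by (rule vector_derivative_at, rule has_vector_derivative_along_tangent[OF assms])

lemma dird_cong:
  assumes "tangentially_open M" "p \<in> M" "v \<in> tangent M" "\<And>q. q \<in> M \<Longrightarrow> f q = g q"
  shows "dird f p v = dird g p v"
  unfolding dird_def
proof (rule vector_derivative_cong_eq)
  have "\<forall>\<^sub>F t in nhds (0::real). p + t *\<^sub>R v \<in> M"
    using assms unfolding tangentially_open_def by blast
  then show "\<forall>\<^sub>F t in nhds 0. t \<in> UNIV \<longrightarrow> f (p + t *\<^sub>R v) = g (p + t *\<^sub>R v)"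
    by eventually_elim (simp add: assms)
qed auto

lemma dird_affine:
  assumes "bounded_linear L"
  shows "dird (\<lambda>q. c + L q) p v = L v"
  unfolding dird_def
  by (rule vector_derivative_at, unfold has_vector_derivative_def)
    (auto intro!: derivative_eq_intros bounded_linear.has_derivative[OF assms]
       simp: linear_simps[OF assms])

lemma dird_zero_direction [simp]: "dird f p 0 = 0"
  by (simp add: dird_def)

lemma dird_add:
  assumes "tangentially_open M" "p \<in> M" "f differentiable_on M" "u \<in> tangent M" "v \<in> tangent M"
  shows "dird f p (u + v) = dird f p u + dird f p v"
proof -
  obtain f' where f': "(f has_derivative f') (at p within M)"
    using assms unfolding differentiable_on_def differentiable_def by blast
  then show ?thesis
    using has_derivative_bounded_linear[OF f'] assms
    by (simp add: dird_eq[OF _ _ _ f'] subspace_add linear_simps)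
qed

lemma dird_scaleR:
  assumes "tangentially_open M" "p \<in> M" "f differentiable_on M" "v \<in> tangent M"
  shows "dird f p (c *\<^sub>R v) = c *\<^sub>R dird f p v"
proof -
  obtain f' where f': "(f has_derivative f') (at p within M)"
    using assms unfolding differentiable_on_def differentiable_def by blast
  then show ?thesis
    using has_derivative_bounded_linear[OF f'] assms
    by (simp add: dird_eq[OF _ _ _ f'] subspace_scale linear_simps)
qed

lemma dird_sum:
  assumes "tangentially_open M" "p \<in> M" "f differentiable_on M" "finite B"
    "\<And>b. b \<in> B \<Longrightarrow> u b \<in> tangent M"
  shows "dird f p (\<Sum>b\<in>B. u b) = (\<Sum>b\<in>B. dird f p (u b))"
  using assms(4,5)
  by (induction B) (simp_all add: dird_add[OF assms(1-3)] subspace_sum)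

lemma dird_bilinear:
  assumes "tangentially_open M" "p \<in> M" "f differentiable_on M" "g differentiable_on M"
    "v \<in> tangent M" "bounded_bilinear h"
  shows "dird (\<lambda>q. h (f q) (g q)) p v = h (f p) (dird g p v) + h (dird f p v) (g p)"
proof -
  obtain f' g' where d: "(f has_derivative f') (at p within M)" "(g has_derivative g') (at p within M)"
    using assms unfolding differentiable_on_def differentiable_def by blast
  show ?thesis
    using dird_eq[OF assms(1,2,5) bounded_bilinear.FDERIV[OF assms(6) d]]
    by (simp add: dird_eq[OF assms(1,2,5) d(1)] dird_eq[OF assms(1,2,5) d(2)])
qed

lemma dird_plus:
  assumes "tangentially_open M" "p \<in> M" "f differentiable_on M" "g differentiable_on M"
    "v \<in> tangent M"
  shows "dird (\<lambda>q. f q + g q) p v = dird f p v + dird g p v"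
proof -
  obtain f' g' where d: "(f has_derivative f') (at p within M)" "(g has_derivative g') (at p within M)"
    using assms unfolding differentiable_on_def differentiable_def by blast
  show ?thesis
    using dird_eq[OF assms(1,2,5) has_derivative_add[OF d]]
    by (simp add: dird_eq[OF assms(1,2,5) d(1)] dird_eq[OF assms(1,2,5) d(2)])
qed

lemma dird_bounded_linear:
  assumes "tangentially_open M" "p \<in> M" "f differentiable_on M" "v \<in> tangent M" "bounded_linear L"
  shows "dird (\<lambda>q. L (f q)) p v = L (dird f p v)"
proof -
  obtain f' where d: "(f has_derivative f') (at p within M)"
    using assms unfolding differentiable_on_def differentiable_def by blast
  show ?thesis
    using dird_eq[OF assms(1,2,4) bounded_linear.has_derivative[OF assms(5) d]]
    by (simp add: dird_eq[OF assms(1,2,4) d])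
qed

lemma dird_inverse:
  fixes f :: "'a::euclidean_space \<Rightarrow> real"
  assumes "tangentially_open M" "p \<in> M" "f differentiable_on M" "v \<in> tangent M" "f p \<noteq> 0"
  shows "dird (\<lambda>q. inverse (f q)) p v = - (dird f p v * (inverse (f p) * inverse (f p)))"
proof -
  obtain f' where d: "(f has_derivative f') (at p within M)"
    using assms unfolding differentiable_on_def differentiable_def by blast
  show ?thesis
    using dird_eq[OF assms(1,2,4) Deriv.has_derivative_inverse[OF assms(5) d]]
    by (simp add: dird_eq[OF assms(1,2,4) d] ac_simps)
qed

text \<open>A subspace is the common kernel of the functionals \<open>inner w\<close> with
  \<open>w\<close> in its orthogonal complement. Each of them vanishes along \<open>f\<close>, hence
  also on the derivative. This makes the flat derivative of a vector field tangent again.\<close>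

lemma dird_in_subspace:
  fixes f :: "'a::euclidean_space \<Rightarrow> 'b::euclidean_space"
  assumes M: "tangentially_open M" and p: "p \<in> M" and v: "v \<in> tangent M"
    and f: "f differentiable_on M" and V: "subspace V" "\<And>q. q \<in> M \<Longrightarrow> f q \<in> V"
  shows "dird f p v \<in> V"
proof -
  have "inner w (dird f p v) = 0" if "w \<in> orthogonal_comp V" for w
  proof -
    have "inner w (dird f p v) = dird (\<lambda>q. inner w (f q)) p v"
      by (rule dird_bounded_linear[OF M p f v bounded_linear_inner_right, symmetric])
    also have "\<dots> = dird (\<lambda>q. 0::real) p v"
      using that V(2) by (intro dird_cong[OF M p v]) (auto simp: orthogonal_comp_def orthogonal_def inner_commute)
    finally show ?thesis by (simp add: dird_def)
  qed
  then have "dird f p v \<in> orthogonal_comp (orthogonal_comp V)"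
    by (auto simp: orthogonal_comp_def orthogonal_def)
  then show ?thesis by (simp add: orthogonal_comp_self[OF V(1)])
qed

section \<open>Iterated differentiability and its closure properties\<close>

lemma Ck_on_cong:
  assumes "tangentially_open M" "\<And>p. p \<in> M \<Longrightarrow> f p = g p"
  shows "Ck_on k M f = Ck_on k M g"
  using assms(2)
proof (induction k arbitrary: f g)
  case 0
  then show ?case by (simp cong: continuous_on_cong)
next
  case (Suc k)
  have "(f differentiable_on M) = (g differentiable_on M)"
    using Suc.prems unfolding differentiable_on_def
    by (auto intro: differentiable_transform_within[OF _ zero_less_one])
  moreover have "Ck_on k M (\<lambda>p. dird f p v) = Ck_on k M (\<lambda>p. dird g p v)" if "v \<in> tangent M" for v
    by (rule Suc.IH) (rule dird_cong[OF assms(1) _ that Suc.prems])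
  ultimately show ?case by simp
qed

lemma Ck_on_transform:
  assumes "Ck_on k M g" "tangentially_open M" "\<And>p. p \<in> M \<Longrightarrow> f p = g p"
  shows "Ck_on k M f"
  using assms Ck_on_cong by blast

lemma Ck_on_Suc_lower: "Ck_on (Suc k) M f \<Longrightarrow> Ck_on k M f"
proof (induction k arbitrary: f)
  case 0
  then show ?case by (simp add: differentiable_imp_continuous_on)
next
  case (Suc k)
  then show ?case by (metis Ck_on.simps(2))
qed

lemma Ck_on_const: "Ck_on k M (\<lambda>p. c)"
proof (induction k arbitrary: c)
  case (Suc k)
  then show ?case by (simp add: dird_def)
qed simp

lemma Ck_on_affine:
  assumes "bounded_linear L" shows "Ck_on k M (\<lambda>p. c + L p)"
  using assms
  by (cases k) (simp_all add: dird_affine Ck_on_const continuous_on_add linear_continuous_on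
        differentiable_on_add bounded_linear_imp_differentiable_on)

lemma Ck_on_add:
  assumes "tangentially_open M"
  shows "Ck_on k M f \<Longrightarrow> Ck_on k M g \<Longrightarrow> Ck_on k M (\<lambda>p. f p + g p)"
proof (induction k arbitrary: f g)
  case 0
  then show ?case by (simp add: continuous_on_add)
next
  case (Suc k)
  then show ?case
    by (auto simp: Ck_on_cong[OF assms dird_plus[OF assms]])
qed

lemma Ck_on_bounded_linear:
  assumes "tangentially_open M" "bounded_linear L"
  shows "Ck_on k M f \<Longrightarrow> Ck_on k M (\<lambda>p. L (f p))"
proof (induction k arbitrary: f)
  case 0
  then show ?case by (simp add: bounded_linear.continuous_on[OF assms(2)])
next
  case (Suc k)
  then show ?case
    using bounded_linear.has_derivative[OF assms(2)]
    by (auto simp: Ck_on_cong[OF assms(1) dird_bounded_linear[OF assms(1) _ _ _ assms(2)]]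
        differentiable_on_def differentiable_def) blast+
qed

lemma Ck_on_sum:
  assumes "tangentially_open M" "finite B" "\<And>b. b \<in> B \<Longrightarrow> Ck_on k M (f b)"
  shows "Ck_on k M (\<lambda>p. \<Sum>b\<in>B. f b p)"
  using assms(2,3) by (induction B) (simp_all add: Ck_on_const Ck_on_add[OF assms(1)])

lemma Ck_on_bilinear:
  assumes "tangentially_open M" "bounded_bilinear h"
  shows "Ck_on k M f \<Longrightarrow> Ck_on k M g \<Longrightarrow> Ck_on k M (\<lambda>p. h (f p) (g p))"
proof (induction k arbitrary: f g)
  case 0
  then show ?case by (simp add: bounded_bilinear.continuous_on[OF assms(2)])
next
  case (Suc k)
  have "(\<lambda>p. h (f p) (g p)) differentiable_on M"
    using Suc.prems bounded_bilinear.FDERIV[OF assms(2)]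
    unfolding Ck_on.simps differentiable_on_def differentiable_def by blast
  moreover have "Ck_on k M (\<lambda>p. dird (\<lambda>p. h (f p) (g p)) p v)" if v: "v \<in> tangent M" for v
  proof -
    have "Ck_on k M (\<lambda>p. h (f p) (dird g p v) + h (dird f p v) (g p))"
      using Suc v Ck_on_Suc_lower[OF Suc.prems(1)] Ck_on_Suc_lower[OF Suc.prems(2)]
      by (intro Ck_on_add[OF assms(1)]) auto
    then show ?thesis
      by (rule Ck_on_transform[OF _ assms(1)])
        (rule dird_bilinear[OF assms(1) _ _ _ v assms(2)], use Suc.prems in auto)
  qed
  ultimately show ?case by simp
qed

lemma Ck_on_inverse:
  fixes f :: "'a::euclidean_space \<Rightarrow> real"
  assumes "tangentially_open M" "\<And>p. p \<in> M \<Longrightarrow> f p \<noteq> 0"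
  shows "Ck_on k M f \<Longrightarrow> Ck_on k M (\<lambda>p. inverse (f p))"
proof (induction k)
  case 0
  then show ?case using assms(2) by (simp add: continuous_on_inverse)
next
  case (Suc k)
  have "(\<lambda>p. inverse (f p)) differentiable_on M"
    using Suc.prems assms(2) by (auto simp: differentiable_on_def)
  moreover have "Ck_on k M (\<lambda>p. dird (\<lambda>p. inverse (f p)) p v)" if v: "v \<in> tangent M" for v
  proof -
    have "Ck_on k M (\<lambda>p. inverse (f p))"
      using Suc.IH Ck_on_Suc_lower[OF Suc.prems] by blast
    then have "Ck_on k M (\<lambda>p. - (dird f p v * (inverse (f p) * inverse (f p))))"
      using Suc.prems v
      by (intro Ck_on_bounded_linear[OF assms(1) bounded_linear_minus[OF bounded_linear_ident]]
          Ck_on_bilinear[OF assms(1) bounded_bilinear_mult]) auto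
    then show ?thesis
      by (rule Ck_on_transform[OF _ assms(1)])
        (rule dird_inverse[OF assms(1) _ _ v], use Suc.prems assms(2) in auto)
  qed
  ultimately show ?case by simp
qed

lemma tangent_affine_image:
  assumes "bounded_linear L" "(\<lambda>p. c + L p) ` M \<subseteq> N" "v \<in> tangent M"
  shows "L v \<in> tangent N"
proof -
  have "subspace {v. L v \<in> tangent N}"
    using linear_subspace_vimage[OF bounded_linear.linear[OF assms(1)] subspace_tangent]
    by (simp add: vimage_def)
  moreover have "{p - q | p q. p \<in> M \<and> q \<in> M} \<subseteq> {v. L v \<in> tangent N}"
  proof safe
    fix p q assume "p \<in> M" "q \<in> M"
    then have "(c + L p) - (c + L q) \<in> tangent N"
      using assms(2) by (intro diff_in_tangent) auto
    then show "L (p - q) \<in> tangent N" using assms(1) by (simp add: linear_simps)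
  qed
  ultimately show ?thesis
    using assms(3) span_minimal unfolding tangent_def[of M] by blast
qed

lemma differentiable_on_affine_compose:
  assumes "bounded_linear L" "(\<lambda>p. c + L p) ` M \<subseteq> N" "f differentiable_on N"
  shows "(\<lambda>p. f (c + L p)) differentiable_on M"
  unfolding differentiable_on_def
proof
  fix p assume p: "p \<in> M"
  have "(\<lambda>p. c + L p) differentiable (at p within M)"
    using assms(1) by (simp add: differentiable_add bounded_linear_imp_differentiable)
  moreover have "f differentiable (at (c + L p) within (\<lambda>p. c + L p) ` M)"
    using assms(2,3) p unfolding differentiable_on_def
    by (meson differentiable_within_subset image_subset_iff)
  ultimately have "(f \<circ> (\<lambda>p. c + L p)) differentiable (at p within M)"
    using differentiable_chain_within by blast
  then show "(\<lambda>p. f (c + L p)) differentiable (at p within M)" by (simp add: o_def)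
qed

text \<open>Both sides differentiate literally the same curve, so the identity holds even where the
  derivative does not exist.\<close>

lemma dird_affine_compose:
  assumes "bounded_linear L"
  shows "dird (\<lambda>p. f (c + L p)) p v = dird f (c + L p) (L v)"
  unfolding dird_def by (simp add: linear_simps[OF assms] add.assoc)

lemma Ck_on_affine_compose:
  assumes "bounded_linear L" "(\<lambda>p. c + L p) ` M \<subseteq> N"
  shows "Ck_on k N f \<Longrightarrow> Ck_on k M (\<lambda>p. f (c + L p))"
proof (induction k arbitrary: f)
  case 0
  then show ?case
    using assms continuous_on_compose2[of N f M "\<lambda>p. c + L p"]
    by (simp add: continuous_on_add linear_continuous_on)
next
  case (Suc k)
  then show ?case
    using differentiable_on_affine_compose[OF assms] tangent_affine_image[OF assms]
    by (auto simp: dird_affine_compose[OF assms(1)])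
qed

section \<open>Connections given by Christoffel symbols\<close>

lemma smooth_on_transform:
  assumes "smooth_on M g" "tangentially_open M" "\<And>p. p \<in> M \<Longrightarrow> f p = g p"
  shows "smooth_on M f"
  using assms Ck_on_transform unfolding smooth_on_def by blast

lemma smooth_on_differentiable: "smooth_on M f \<Longrightarrow> f differentiable_on M"
  unfolding smooth_on_def by (metis Ck_on.simps(2))

lemma smooth_on_const: "smooth_on M (\<lambda>p. c)"
  by (simp add: smooth_on_def Ck_on_const)

lemma smooth_on_affine: "bounded_linear L \<Longrightarrow> smooth_on M (\<lambda>p. c + L p)"
  by (simp add: smooth_on_def Ck_on_affine)

lemma smooth_on_linear: "bounded_linear L \<Longrightarrow> smooth_on M L"
  using smooth_on_affine[of L M 0] by simp

lemma smooth_on_add: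
  "tangentially_open M \<Longrightarrow> smooth_on M f \<Longrightarrow> smooth_on M g \<Longrightarrow> smooth_on M (\<lambda>p. f p + g p)"
  by (simp add: smooth_on_def Ck_on_add)

lemma smooth_on_bounded_linear:
  "tangentially_open M \<Longrightarrow> bounded_linear L \<Longrightarrow> smooth_on M f \<Longrightarrow> smooth_on M (\<lambda>p. L (f p))"
  by (simp add: smooth_on_def Ck_on_bounded_linear)

lemma smooth_on_bilinear:
  "tangentially_open M \<Longrightarrow> bounded_bilinear h \<Longrightarrow> smooth_on M f \<Longrightarrow> smooth_on M g \<Longrightarrow>
    smooth_on M (\<lambda>p. h (f p) (g p))"
  by (simp add: smooth_on_def Ck_on_bilinear)

lemmas smooth_on_mult = smooth_on_bilinear[OF _ bounded_bilinear_mult]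
lemmas smooth_on_scaleR = smooth_on_bilinear[OF _ bounded_bilinear_scaleR]

lemma smooth_on_divide:
  fixes f g :: "'a::euclidean_space \<Rightarrow> real"
  assumes "tangentially_open M" "smooth_on M f" "smooth_on M g" "\<And>p. p \<in> M \<Longrightarrow> g p \<noteq> 0"
  shows "smooth_on M (\<lambda>p. f p / g p)"
  unfolding divide_inverse
  using assms by (intro smooth_on_mult) (auto simp: smooth_on_def Ck_on_inverse)

lemma smooth_on_dird: "smooth_on M f \<Longrightarrow> v \<in> tangent M \<Longrightarrow> smooth_on M (\<lambda>p. dird f p v)"
  unfolding smooth_on_def by (metis Ck_on.simps(2))

lemma smooth_on_sum:
  "tangentially_open M \<Longrightarrow> finite B \<Longrightarrow> (\<And>b. b \<in> B \<Longrightarrow> smooth_on M (f b)) \<Longrightarrow>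
    smooth_on M (\<lambda>p. \<Sum>b\<in>B. f b p)"
  by (simp add: smooth_on_def Ck_on_sum)

lemma smooth_on_affine_compose:
  "bounded_linear L \<Longrightarrow> (\<lambda>p. c + L p) ` M \<subseteq> N \<Longrightarrow> smooth_on N f \<Longrightarrow> smooth_on M (\<lambda>p. f (c + L p))"
  by (simp add: smooth_on_def Ck_on_affine_compose)

text \<open>\<open>Ck_on\<close> speaks of constant directions only, whereas here the direction
  varies with the point. Expanding \<open>X\<close> in an orthonormal basis of the tangent space
  leaves constant directions with smooth coefficients.\<close>

lemma smooth_on_dird_field:
  assumes M: "tangentially_open M" and X: "smooth_on M X" "\<And>p. p \<in> M \<Longrightarrow> X p \<in> tangent M"
    and Y: "smooth_on M Y"
  shows "smooth_on M (\<lambda>p. dird Y p (X p))"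
proof -
  obtain B where B: "B \<subseteq> tangent M" "pairwise orthogonal B" "\<And>x. x \<in> B \<Longrightarrow> norm x = 1"
      "independent B" "span B = tangent M"
    using orthonormal_basis_subspace[OF subspace_tangent] by metis
  have finB: "finite B" using B(4) by (rule independent_imp_finite)
  have "smooth_on M (\<lambda>p. \<Sum>b\<in>B. (X p \<bullet> b) *\<^sub>R dird Y p b)"
  proof (rule smooth_on_sum[OF M finB])
    fix b assume "b \<in> B"
    then show "smooth_on M (\<lambda>p. (X p \<bullet> b) *\<^sub>R dird Y p b)"
      using B(1) smooth_on_bounded_linear[OF M bounded_linear_inner_left X(1), of b]
      by (intro smooth_on_scaleR[OF M] smooth_on_dird[OF Y]) auto
  qed
  then show ?thesis
  proof (rule smooth_on_transform[OF _ M])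
    fix p assume p: "p \<in> M"
    have "X p = (\<Sum>b\<in>B. (X p \<bullet> b) *\<^sub>R b)"
      using X(2)[OF p] B(2,3,5) finB by (intro orthonormal_basis_expand[symmetric]) auto
    then have "dird Y p (X p) = dird Y p (\<Sum>b\<in>B. (X p \<bullet> b) *\<^sub>R b)" by simp
    also have "\<dots> = (\<Sum>b\<in>B. (X p \<bullet> b) *\<^sub>R dird Y p b)"
      using B(1) dird_scaleR[OF M p smooth_on_differentiable[OF Y]]
      by (subst dird_sum[OF M p smooth_on_differentiable[OF Y] finB])
        (auto simp: subspace_scale intro!: sum.cong)
    finally show "dird Y p (X p) = (\<Sum>b\<in>B. (X p \<bullet> b) *\<^sub>R dird Y p b)" .
  qed
qed

lemma vector_fieldsD:
  assumes "X \<in> vector_fields M"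
  shows "smooth_on M X" "X differentiable_on M" "p \<in> M \<Longrightarrow> X p \<in> tangent M" "p \<notin> M \<Longrightarrow> X p = 0"
  using assms smooth_on_differentiable unfolding vector_fields_def by auto

lemma vector_fieldsI:
  assumes "tangentially_open M" "smooth_on M Y" "\<And>p. p \<in> M \<Longrightarrow> X p = Y p"
    "\<And>p. p \<in> M \<Longrightarrow> Y p \<in> tangent M" "\<And>p. p \<notin> M \<Longrightarrow> X p = 0"
  shows "X \<in> vector_fields M"
  using assms smooth_on_transform[OF assms(2,1,3)] unfolding vector_fields_def by auto

lemma vector_fields_add:
  assumes "tangentially_open M" "X \<in> vector_fields M" "Y \<in> vector_fields M"
  shows "(\<lambda>p. X p + Y p) \<in> vector_fields M"
  using assms unfolding vector_fields_def by (auto simp: smooth_on_add subspace_add)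

lemma vector_fields_scaleR:
  assumes "tangentially_open M" "X \<in> vector_fields M" "smooth_on M (f :: _ \<Rightarrow> real)"
  shows "(\<lambda>p. f p *\<^sub>R X p) \<in> vector_fields M"
  using assms unfolding vector_fields_def by (auto simp: smooth_on_scaleR subspace_scale)

lemma vector_fields_diff:
  assumes "tangentially_open M" "X \<in> vector_fields M" "Y \<in> vector_fields M"
  shows "(\<lambda>p. X p - Y p) \<in> vector_fields M"
  using vector_fields_add[OF assms(1,2) vector_fields_scaleR[OF assms(1,3) smooth_on_const[of M "-1"]]]
  by simp

text \<open>Subtraction of points identifies all tangent spaces, so the derivative of components is
  itself a flat connection and \<Gamma> is the difference from it. The default 0 agrees with the
  last clause of \<open>affine_connection\<close> and with the extension of vector fields by
  0.\<close>

definition christoffel_connection ::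
    "'a::euclidean_space set \<Rightarrow> ('a \<Rightarrow> 'a \<Rightarrow> 'a \<Rightarrow> 'a) \<Rightarrow> 'a connection" where
  "christoffel_connection M \<Gamma> X Y p =
     (if X \<in> vector_fields M \<and> Y \<in> vector_fields M \<and> p \<in> M
      then dird Y p (X p) + \<Gamma> p (X p) (Y p) else 0)"

lemma affine_connection_christoffel:
  assumes M: "tangentially_open M"
    and smooth: "\<And>X Y. X \<in> vector_fields M \<Longrightarrow> Y \<in> vector_fields M \<Longrightarrow>
      smooth_on M (\<lambda>p. \<Gamma> p (X p) (Y p))"
    and tang: "\<And>p u v. p \<in> M \<Longrightarrow> u \<in> tangent M \<Longrightarrow> v \<in> tangent M \<Longrightarrow> \<Gamma> p u v \<in> tangent M"
    and bil: "\<And>p. p \<in> M \<Longrightarrow> bilinear (\<Gamma> p)"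
  shows "affine_connection M (christoffel_connection M \<Gamma>)"
  unfolding affine_connection_def
proof (intro conjI ballI allI impI)
  fix X Y assume X: "X \<in> vector_fields M" and Y: "Y \<in> vector_fields M"
  note dX = vector_fieldsD[OF X] and dY = vector_fieldsD[OF Y]
  show "christoffel_connection M \<Gamma> X Y \<in> vector_fields M"
  proof (rule vector_fieldsI[OF M])
    show "smooth_on M (\<lambda>p. dird Y p (X p) + \<Gamma> p (X p) (Y p))"
      by (rule smooth_on_add[OF M smooth_on_dird_field[OF M dX(1,3) dY(1)] smooth[OF X Y]])
  next
    fix p assume p: "p \<in> M"
    show "dird Y p (X p) + \<Gamma> p (X p) (Y p) \<in> tangent M"
      by (rule subspace_add[OF subspace_tangent
            dird_in_subspace[OF M p dX(3)[OF p] dY(2) subspace_tangent dY(3)]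
            tang[OF p dX(3)[OF p] dY(3)[OF p]]])
  qed (use X Y in \<open>auto simp: christoffel_connection_def\<close>)
  { fix Z assume Z: "Z \<in> vector_fields M"
    note dZ = vector_fieldsD[OF Z]
    show "christoffel_connection M \<Gamma> (\<lambda>p. X p + Y p) Z =
        (\<lambda>p. christoffel_connection M \<Gamma> X Z p + christoffel_connection M \<Gamma> Y Z p)"
      using X Y Z vector_fields_add[OF M X Y]
      by (auto simp: christoffel_connection_def fun_eq_iff dX dY bilinear_ladd[OF bil]
          dird_add[OF M _ dZ(2)])
    show "christoffel_connection M \<Gamma> X (\<lambda>p. Y p + Z p) =
        (\<lambda>p. christoffel_connection M \<Gamma> X Y p + christoffel_connection M \<Gamma> X Z p)"
      using X Y Z vector_fields_add[OF M Y Z]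
      by (auto simp: christoffel_connection_def fun_eq_iff dX bilinear_radd[OF bil]
          dird_plus[OF M _ dY(2) dZ(2)]) }
  { fix f :: "'a \<Rightarrow> real" assume f: "smooth_on M f"
    show "christoffel_connection M \<Gamma> (\<lambda>p. f p *\<^sub>R X p) Y =
        (\<lambda>p. f p *\<^sub>R christoffel_connection M \<Gamma> X Y p)"
      using X Y vector_fields_scaleR[OF M X f]
      by (auto simp: christoffel_connection_def fun_eq_iff dX bilinear_lmul[OF bil]
          dird_scaleR[OF M _ dY(2)] scaleR_add_right)
    show "christoffel_connection M \<Gamma> X (\<lambda>p. f p *\<^sub>R Y p) =
        (\<lambda>p. dird f p (X p) *\<^sub>R Y p + f p *\<^sub>R christoffel_connection M \<Gamma> X Y p)"
      using X Y vector_fields_scaleR[OF M Y f]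
      by (auto simp: christoffel_connection_def fun_eq_iff dX dY bilinear_rmul[OF bil] scaleR_add_right
          dird_bilinear[OF M _ smooth_on_differentiable[OF f] dY(2) _ bounded_bilinear_scaleR]) }
next
  fix X Y :: "'a \<Rightarrow> 'a" assume "X \<notin> vector_fields M \<or> Y \<notin> vector_fields M"
  then show "christoffel_connection M \<Gamma> X Y = (\<lambda>p. 0)"
    by (auto simp: christoffel_connection_def)
qed

text \<open>The Lie bracket is exactly the antisymmetrized flat derivative, and a symmetric \<Gamma>
  drops out of the difference.\<close>

lemma torsion_free_christoffel:
  assumes "\<And>p u v. p \<in> M \<Longrightarrow> \<Gamma> p u v = \<Gamma> p v u"
  shows "torsion_free M (christoffel_connection M \<Gamma>)"
  unfolding torsion_free_def
proof (intro ballI ext)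
  fix X Y p assume "X \<in> vector_fields M" "Y \<in> vector_fields M"
  then show "christoffel_connection M \<Gamma> X Y p - christoffel_connection M \<Gamma> Y X p = lie_bracket M X Y p"
    using assms[of p "X p" "Y p"] by (auto simp: christoffel_connection_def lie_bracket_def)
qed

section \<open>Uniqueness of connections\<close>

lemma affine_connection_vector_fields:
  "affine_connection M D \<Longrightarrow> X \<in> vector_fields M \<Longrightarrow> Y \<in> vector_fields M \<Longrightarrow> D X Y \<in> vector_fields M"
  unfolding affine_connection_def by blast

lemma riemannian_metric_diff:
  assumes "riemannian_metric M g" "p \<in> M" "u \<in> tangent M" "v \<in> tangent M" "w \<in> tangent M"
  shows "g p (u - v) w = g p u w - g p v w"
proof -
  have "g p (u + (-1) *\<^sub>R v) w = g p u w + (-1) * g p v w"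
    using assms unfolding riemannian_metric_def by blast
  then show ?thesis by simp
qed

lemma riemannian_metric_commute:
  "riemannian_metric M g \<Longrightarrow> p \<in> M \<Longrightarrow> u \<in> tangent M \<Longrightarrow> v \<in> tangent M \<Longrightarrow> g p u v = g p v u"
  unfolding riemannian_metric_def by blast

text \<open>The difference of \<open>D X Y\<close> and \<open>D' X Y\<close> is itself an admissible
  test field \<open>Z\<close>. Tested against itself it has length 0, so positive definiteness kills
  it on \<open>M\<close>; elsewhere, and on arguments that are not vector fields, both connections
  are 0.\<close>

lemma affine_connection_eqI:
  assumes M: "tangentially_open M" and g: "riemannian_metric M g"
    and D: "affine_connection M D" "affine_connection M D'"
    and eq: "\<And>X Y Z p. X \<in> vector_fields M \<Longrightarrow> Y \<in> vector_fields M \<Longrightarrow> Z \<in> vector_fields M \<Longrightarrow>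
      p \<in> M \<Longrightarrow> g p (D X Y p) (Z p) = g p (D' X Y p) (Z p)"
  shows "D = D'"
proof (intro ext)
  fix X Y p
  show "D X Y p = D' X Y p"
  proof (cases "X \<in> vector_fields M \<and> Y \<in> vector_fields M")
    case True
    then have V: "D X Y \<in> vector_fields M" "D' X Y \<in> vector_fields M"
      using D affine_connection_vector_fields by auto
    note dV = vector_fieldsD[OF V(1)] vector_fieldsD[OF V(2)]
    show ?thesis
    proof (cases "p \<in> M")
      case p: True
      let ?w = "D X Y p - D' X Y p"
      have "g p ?w ?w = g p (D X Y p) ?w - g p (D' X Y p) ?w"
        using p dV by (intro riemannian_metric_diff[OF g]) (auto intro: subspace_diff)
      also have "\<dots> = 0"
        using eq[OF _ _ vector_fields_diff[OF M V] p] True by simp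
      finally have "\<not> g p ?w ?w > 0" by simp
      moreover have "?w \<in> tangent M" using p dV by (auto intro: subspace_diff)
      ultimately have "?w = 0"
        using g p unfolding riemannian_metric_def by blast
      then show ?thesis by simp
    qed (simp add: dV)
  next
    case False
    then have "D X Y = (\<lambda>p. 0)" "D' X Y = (\<lambda>p. 0)"
      using D unfolding affine_connection_def by blast+
    then show ?thesis by simp
  qed
qed

text \<open>The difference of two torsion-free metric connections gives a trilinear form that is symmetric
  in its first two and antisymmetric in its last two arguments, hence zero.\<close>

lemma levi_civita_unique:
  assumes M: "tangentially_open M" and g: "riemannian_metric M g"
    and D: "affine_connection M D" "torsion_free M D"
      "\<forall>X\<in>vector_fields M. \<forall>Y\<in>vector_fields M. \<forall>Z\<in>vector_fields M. \<forall>p\<in>M. nabla_metric g D X Y Z p = 0"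
    and D': "affine_connection M D'" "torsion_free M D'"
      "\<forall>X\<in>vector_fields M. \<forall>Y\<in>vector_fields M. \<forall>Z\<in>vector_fields M. \<forall>p\<in>M. nabla_metric g D' X Y Z p = 0"
  shows "D = D'"
proof (rule affine_connection_eqI[OF M g D(1) D'(1)])
  define T where "T X Y Z p = g p (D X Y p) (Z p) - g p (D' X Y p) (Z p)" for X Y Z p
  fix X Y Z p
  assume X: "X \<in> vector_fields M" and Y: "Y \<in> vector_fields M" and Z: "Z \<in> vector_fields M" and p: "p \<in> M"
  have tD: "D U V p \<in> tangent M" "D' U V p \<in> tangent M"
    if "U \<in> vector_fields M" "V \<in> vector_fields M" for U V
    using that affine_connection_vector_fields D(1) D'(1) p vector_fieldsD(3) by metis+
  have sym: "T U V W p = T V U W p"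
    if U: "U \<in> vector_fields M" and V: "V \<in> vector_fields M" and W: "W \<in> vector_fields M" for U V W
  proof -
    have "D U V p - D V U p = D' U V p - D' V U p"
      using D(2) D'(2) U V unfolding torsion_free_def by metis
    then have "D U V p - D' U V p = D V U p - D' V U p" by (simp add: algebra_simps)
    then have "g p (D U V p - D' U V p) (W p) = g p (D V U p - D' V U p) (W p)" by simp
    then show ?thesis
      using U V W p vector_fieldsD(3)[OF W p] by (simp add: T_def riemannian_metric_diff[OF g] tD)
  qed
  have antisym: "T U V W p = - T U W V p"
    if U: "U \<in> vector_fields M" and V: "V \<in> vector_fields M" and W: "W \<in> vector_fields M" for U V W
  proof -
    have "nabla_metric g D U V W p = nabla_metric g D' U V W p"
      using D(3) D'(3) U V W p by simp
    then have "g p (D U V p) (W p) + g p (V p) (D U W p) = g p (D' U V p) (W p) + g p (V p) (D' U W p)"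
      by (simp add: nabla_metric_def)
    then show ?thesis
      using riemannian_metric_commute[OF g p vector_fieldsD(3)[OF V p] tD(1)[OF U W]]
        riemannian_metric_commute[OF g p vector_fieldsD(3)[OF V p] tD(2)[OF U W]]
      by (simp add: T_def)
  qed
  \<comment> \<open>Six alternating swaps return to the original order of the arguments. Three of
    them change the sign, so \<open>T\<close> equals its own negative.\<close>
  have "T X Y Z p = 0"
    using sym[OF X Y Z] antisym[OF Y X Z] sym[OF Y Z X] antisym[OF Z Y X] sym[OF Z X Y] antisym[OF X Z Y]
    by simp
  then show "g p (D X Y p) (Z p) = g p (D' X Y p) (Z p)" by (simp add: T_def)
qed

lemma levi_civita_eqI:
  assumes "tangentially_open M" "riemannian_metric M g" "affine_connection M D" "torsion_free M D"
    "\<forall>X\<in>vector_fields M. \<forall>Y\<in>vector_fields M. \<forall>Z\<in>vector_fields M. \<forall>p\<in>M. nabla_metric g D X Y Z p = 0"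
  shows "levi_civita M g = D"
  unfolding levi_civita_def
  using assms levi_civita_unique[OF assms(1,2)] by (intro the_equality) blast+

section \<open>Transport along affine isomorphisms\<close>

locale affine_isomorphism =
  fixes M :: "'a::euclidean_space set" and N :: "'b::euclidean_space set"
    and \<phi> c L \<psi> d K
  assumes M: "tangentially_open M" and N: "tangentially_open N"
    and L: "bounded_linear L" and K: "bounded_linear K"
    and \<phi>_eq: "\<phi> = (\<lambda>p. c + L p)" and \<psi>_eq: "\<psi> = (\<lambda>q. d + K q)"
    and \<phi>_mem: "p \<in> M \<Longrightarrow> \<phi> p \<in> N" and \<psi>_mem: "q \<in> N \<Longrightarrow> \<psi> q \<in> M"
    and \<psi>_\<phi>: "p \<in> M \<Longrightarrow> \<psi> (\<phi> p) = p" and \<phi>_\<psi>: "q \<in> N \<Longrightarrow> \<phi> (\<psi> q) = q"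
begin

lemma inverse_affine_isomorphism: "affine_isomorphism N M \<psi> d K \<phi> c L"
  using M N L K \<phi>_eq \<psi>_eq \<phi>_mem \<psi>_mem \<psi>_\<phi> \<phi>_\<psi>
  by (intro affine_isomorphism.intro)

lemma image_eq: "\<phi> ` M = N"
  using \<phi>_mem \<psi>_mem \<phi>_\<psi> by force

lemma inj: "inj_on \<phi> M"
  by (metis inj_onI \<psi>_\<phi>)

lemma inv_into_eq: "q \<in> N \<Longrightarrow> inv_into M \<phi> q = \<psi> q"
  by (metis inv_into_f_f inj \<psi>_mem \<phi>_\<psi>)

lemma dird_\<phi>: "dird \<phi> p v = L v"
  unfolding \<phi>_eq by (rule dird_affine[OF L])

lemma L_tangent: "v \<in> tangent M \<Longrightarrow> L v \<in> tangent N"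
  using tangent_affine_image[OF L, of c M N] image_eq unfolding \<phi>_eq by blast

text \<open>The ambient spaces may differ in dimension, so \<open>K\<close> inverts \<open>L\<close>
  on tangent vectors and possibly nowhere else. On a difference of two points the translation parts
  cancel and the claim reduces to \<open>\<psi>\<close> inverting \<open>\<phi>\<close>; linearity
  extends it to the span.\<close>

lemma K_L:
  assumes "v \<in> tangent M" shows "K (L v) = v"
proof -
  have "linear (K \<circ> L)"
    using L K by (intro linear_compose) (auto simp: bounded_linear.linear)
  moreover have "(K \<circ> L) x = id x" if x: "x \<in> {p - q | p q. p \<in> M \<and> q \<in> M}" for x
  proof -
    obtain p q where pq: "p \<in> M" "q \<in> M" "x = p - q" using x by blast
    have "K (L x) = \<psi> (\<phi> p) - \<psi> (\<phi> q)"
      unfolding \<phi>_eq \<psi>_eq pq by (simp add: linear_simps[OF L] linear_simps[OF K])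
    then show ?thesis using pq \<psi>_\<phi> by simp
  qed
  ultimately have "(K \<circ> L) v = id v"
    by (rule linear_eq_on_span[OF _ linear_id]) (use assms in \<open>auto simp: tangent_def\<close>)
  then show ?thesis by simp
qed

lemma smooth_\<phi>: "smooth_on M \<phi>"
  unfolding \<phi>_eq by (rule smooth_on_affine[OF L])

lemma pushforward_eq: "pushforward \<phi> M X q = (if q \<in> N then L (X (\<psi> q)) else 0)"
  by (simp add: pushforward_def image_eq inv_into_eq dird_\<phi>)

lemma pushforward_vector_fields:
  assumes X: "X \<in> vector_fields M"
  shows "pushforward \<phi> M X \<in> vector_fields N"
proof (rule vector_fieldsI[OF N])
  have "(\<lambda>q. d + K q) ` N \<subseteq> M" using \<psi>_mem unfolding \<psi>_eq by blast
  then show "smooth_on N (\<lambda>q. L (X (d + K q)))"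
    by (rule smooth_on_bounded_linear[OF N L smooth_on_affine_compose[OF K _ vector_fieldsD(1)[OF X]]])
qed (use vector_fieldsD[OF X] \<psi>_mem L_tangent in \<open>auto simp: pushforward_eq \<psi>_eq\<close>)

text \<open>An affine map has no second derivative, so the flat derivative commutes with the
  pushforward without any correction term. Only the Christoffel symbols have to be matched.\<close>

lemma pushforward_christoffel:
  assumes X: "X \<in> vector_fields M" and Y: "Y \<in> vector_fields M"
    and \<Gamma>: "\<And>p u v. p \<in> M \<Longrightarrow> u \<in> tangent M \<Longrightarrow> v \<in> tangent M \<Longrightarrow> \<Gamma>' (\<phi> p) (L u) (L v) = L (\<Gamma> p u v)"
  shows "pushforward \<phi> M (christoffel_connection M \<Gamma> X Y) =
    christoffel_connection N \<Gamma>' (pushforward \<phi> M X) (pushforward \<phi> M Y)"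
proof
  fix q
  show "pushforward \<phi> M (christoffel_connection M \<Gamma> X Y) q =
    christoffel_connection N \<Gamma>' (pushforward \<phi> M X) (pushforward \<phi> M Y) q"
  proof (cases "q \<in> N")
    case q: True
    have Xq: "X (\<psi> q) \<in> tangent M" and Yq: "Y (\<psi> q) \<in> tangent M"
      using vector_fieldsD(3) X Y \<psi>_mem[OF q] by auto
    have sub: "(\<lambda>q. d + K q) ` N \<subseteq> M" using \<psi>_mem unfolding \<psi>_eq by blast
    have "dird (pushforward \<phi> M Y) q (L (X (\<psi> q))) = dird (\<lambda>q. L (Y (d + K q))) q (L (X (\<psi> q)))"
      using q by (intro dird_cong[OF N q L_tangent[OF Xq]]) (simp add: pushforward_eq \<psi>_eq)
    also have "\<dots> = L (dird (\<lambda>q. Y (d + K q)) q (L (X (\<psi> q))))"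
      by (intro dird_bounded_linear[OF N q _ L_tangent[OF Xq] L]
          differentiable_on_affine_compose[OF K sub] vector_fieldsD(2)[OF Y])
    also have "\<dots> = L (dird Y (\<psi> q) (X (\<psi> q)))"
      by (simp add: dird_affine_compose[OF K] K_L[OF Xq]) (simp add: \<psi>_eq)
    finally show ?thesis
      using X Y q pushforward_vector_fields[OF X] pushforward_vector_fields[OF Y]
        \<Gamma>[OF \<psi>_mem[OF q] Xq Yq] \<psi>_mem[OF q]
      by (simp add: christoffel_connection_def pushforward_eq[of X] pushforward_eq[of Y]
          pushforward_eq[of "christoffel_connection M \<Gamma> X Y"] \<phi>_\<psi> linear_simps[OF L])
  qed (simp add: christoffel_connection_def pushforward_eq)
qed

interpretation inv: affine_isomorphism N M \<psi> d K \<phi> c L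
  by (rule inverse_affine_isomorphism)

lemma diffeomorphism: "diffeomorphism \<phi> M N"
  unfolding diffeomorphism_def
  using inj image_eq smooth_\<phi> smooth_on_transform[OF inv.smooth_\<phi> N inv_into_eq]
  by (auto simp: bij_betw_def)

text \<open>\<open>transport_connection\<close> is phrased with \<open>inv_into\<close>, which
  agrees with the affine map \<open>\<psi>\<close> on \<open>N\<close> but is unspecified elsewhere.
  Since \<open>U\<close> is tangent, its directional derivatives see only \<open>N\<close>.\<close>

lemma pushforward_inv_into:
  assumes U: "U \<in> vector_fields N"
  shows "pushforward (inv_into M \<phi>) N U = pushforward \<psi> N U"
proof
  fix p
  have im: "inv_into M \<phi> ` N = M"
    using inv.image_eq inv_into_eq by force
  have bij: "inj_on (inv_into M \<phi>) N"
    using inj_on_inv_into[of N \<phi> M] image_eq by simp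
  have "inv_into N (inv_into M \<phi>) p = \<phi> p" if "p \<in> M" for p
    using that bij by (metis inv_into_f_f \<phi>_mem inv_into_eq \<psi>_\<phi>)
  moreover have "dird (inv_into M \<phi>) (\<phi> p) (U (\<phi> p)) = dird \<psi> (\<phi> p) (U (\<phi> p))" if "p \<in> M"
    using that \<phi>_mem by (intro dird_cong[OF N] vector_fieldsD(3)[OF U] inv_into_eq) auto
  ultimately show "pushforward (inv_into M \<phi>) N U p = pushforward \<psi> N U p"
    by (simp add: inv.pushforward_eq inv.dird_\<phi>) (simp add: pushforward_def im inv.dird_\<phi>)
qed

lemma pushforward_pushforward:
  assumes U: "U \<in> vector_fields N"
  shows "pushforward \<phi> M (pushforward \<psi> N U) = U"
  using vector_fieldsD(3,4)[OF U] inv.K_L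
  by (auto simp: fun_eq_iff pushforward_eq inv.pushforward_eq \<psi>_mem \<phi>_\<psi>)

lemma transport_christoffel:
  assumes \<Gamma>: "\<And>p u v. p \<in> M \<Longrightarrow> u \<in> tangent M \<Longrightarrow> v \<in> tangent M \<Longrightarrow> \<Gamma>' (\<phi> p) (L u) (L v) = L (\<Gamma> p u v)"
  shows "transport_connection \<phi> M (christoffel_connection M \<Gamma>) = christoffel_connection N \<Gamma>'"
proof (intro ext)
  fix U V q
  show "transport_connection \<phi> M (christoffel_connection M \<Gamma>) U V q = christoffel_connection N \<Gamma>' U V q"
  proof (cases "U \<in> vector_fields N \<and> V \<in> vector_fields N")
    case True
    then have "transport_connection \<phi> M (christoffel_connection M \<Gamma>) U V =
        pushforward \<phi> M (christoffel_connection M \<Gamma> (pushforward \<psi> N U) (pushforward \<psi> N V))"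
      by (simp add: transport_connection_def image_eq pushforward_inv_into)
    also have "\<dots> = christoffel_connection N \<Gamma>' U V"
      using True pushforward_christoffel[of "pushforward \<psi> N U" "pushforward \<psi> N V" \<Gamma>' \<Gamma>, OF _ _ \<Gamma>]
      by (simp add: pushforward_pushforward inv.pushforward_vector_fields)
    finally show ?thesis by simp
  next
    case False
    then show ?thesis by (auto simp: transport_connection_def image_eq christoffel_connection_def)
  qed
qed

end

section \<open>The half-plane geometry in abstract linear coordinates\<close>

text \<open>Polarization of the classical symbols of the normal family: (1 - \<alpha>)/(2y) along
  \<open>ay\<close> for the pair (x, x), -(1 + \<alpha>)/y along \<open>ax\<close> for the mixed
  pairs, and -(1 + 2\<alpha>)/y along \<open>ay\<close> for (y, y).\<close>

definition alpha_christoffel ::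
    "('a \<Rightarrow> real) \<Rightarrow> ('a \<Rightarrow> real) \<Rightarrow> 'a \<Rightarrow> 'a \<Rightarrow> real \<Rightarrow> 'a \<Rightarrow> 'a \<Rightarrow> 'a \<Rightarrow> 'a::real_vector" where
  "alpha_christoffel cx cy ax ay \<alpha> p u v =
     (- (1 + \<alpha>) * (cx u * cy v + cy u * cx v) / cy p) *\<^sub>R ax +
     (((1 - \<alpha>) / 2 * (cx u * cx v) - (1 + 2 * \<alpha>) * (cy u * cy v)) / cy p) *\<^sub>R ay"

text \<open>The functionals \<open>cx\<close> and \<open>cy\<close> play two roles, as components of
  tangent vectors and, in the case of \<open>cy\<close>, as the coordinate y of the base point. This
  is possible because the coordinates are linear on the ambient space. The metric is prescribed only
  where it is meaningful, at points of \<open>M\<close> and on tangent vectors.\<close>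

locale half_plane_model =
  fixes M :: "'a::euclidean_space set" and cx cy :: "'a \<Rightarrow> real" and ax ay :: 'a and g :: "'a metric"
  assumes affine_domain: "affine_domain M"
    and cx: "bounded_linear cx" and cy: "bounded_linear cy"
    and coords [simp]: "cx ax = 1" "cx ay = 0" "cy ax = 0" "cy ay = 1"
    and tangent_eq: "tangent M = span {ax, ay}"
    and cy_pos: "p \<in> M \<Longrightarrow> cy p > 0"
    and g_eq: "p \<in> M \<Longrightarrow> u \<in> tangent M \<Longrightarrow> v \<in> tangent M \<Longrightarrow>
      g p u v = (cx u * cx v + 2 * (cy u * cy v)) / (cy p)\<^sup>2"
begin

abbreviation \<Gamma> where "\<Gamma> \<equiv> alpha_christoffel cx cy ax ay"

abbreviation nabla where "nabla \<alpha> \<equiv> christoffel_connection M (\<Gamma> \<alpha>)"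

text \<open>The Amari-Chentsov tensor in coordinates: with z standard normal, 2 is the expectation
  of z^2 (z^2 - 1) and 8 that of (z^2 - 1)^3, while the components with an odd number of x-slots
  vanish.\<close>

definition cubic_form where
  "cubic_form p u v w = (2 * (cx u * cx v * cy w + cx u * cy v * cx w + cy u * cx v * cx w)
     + 8 * (cy u * cy v * cy w)) / (cy p) ^ 3"

lemma M: "tangentially_open M"
  by (rule affine_domain_tangentially_open[OF affine_domain])

lemmas coordinate_simps = linear_simps[OF cx] linear_simps[OF cy]

lemma combination_tangent [simp]: "a *\<^sub>R ax + b *\<^sub>R ay \<in> tangent M"
  unfolding tangent_eq by (intro span_add span_scale span_base) auto

lemma frame_tangent [simp]: "ax \<in> tangent M" "ay \<in> tangent M"
  by (auto simp: tangent_eq intro!: span_base)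

lemma tangent_expand:
  assumes "u \<in> tangent M" shows "u = cx u *\<^sub>R ax + cy u *\<^sub>R ay"
proof -
  have "linear (\<lambda>u. cx u *\<^sub>R ax + cy u *\<^sub>R ay)"
    by (rule linearI) (simp_all add: coordinate_simps algebra_simps)
  then have "id u = (\<lambda>u. cx u *\<^sub>R ax + cy u *\<^sub>R ay) u"
    by (rule linear_eq_on_span[OF linear_id]) (use assms in \<open>auto simp: tangent_eq\<close>)
  then show ?thesis by simp
qed

lemma tangent_eqI: "u \<in> tangent M \<Longrightarrow> v \<in> tangent M \<Longrightarrow> cx u = cx v \<Longrightarrow> cy u = cy v \<Longrightarrow> u = v"
  using tangent_expand by metis

lemma \<Gamma>_tangent [simp]: "\<Gamma> \<alpha> p u v \<in> tangent M"
  by (simp add: alpha_christoffel_def)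

lemma coordinates_\<Gamma>:
  "cx (\<Gamma> \<alpha> p u v) = - (1 + \<alpha>) * (cx u * cy v + cy u * cx v) / cy p"
  "cy (\<Gamma> \<alpha> p u v) = ((1 - \<alpha>) / 2 * (cx u * cx v) - (1 + 2 * \<alpha>) * (cy u * cy v)) / cy p"
  by (simp_all add: alpha_christoffel_def coordinate_simps)

lemma smooth_cx: "X \<in> vector_fields M \<Longrightarrow> smooth_on M (\<lambda>p. cx (X p))"
  by (rule smooth_on_bounded_linear[OF M cx vector_fieldsD(1)])

lemma smooth_cy: "X \<in> vector_fields M \<Longrightarrow> smooth_on M (\<lambda>p. cy (X p))"
  by (rule smooth_on_bounded_linear[OF M cy vector_fieldsD(1)])

lemma smooth_over_cy: "smooth_on M f \<Longrightarrow> smooth_on M (\<lambda>p. f p / cy p)"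
  using cy_pos by (intro smooth_on_divide[OF M _ smooth_on_linear[OF cy]]) force+

lemma smooth_\<Gamma>:
  assumes "X \<in> vector_fields M" "Y \<in> vector_fields M"
  shows "smooth_on M (\<lambda>p. \<Gamma> \<alpha> p (X p) (Y p))"
proof -
  note s = smooth_cx[OF assms(1)] smooth_cx[OF assms(2)] smooth_cy[OF assms(1)] smooth_cy[OF assms(2)]
  have 1: "smooth_on M (\<lambda>p. - (1 + \<alpha>) * (cx (X p) * cy (Y p) + cy (X p) * cx (Y p)) / cy p)"
    by (intro smooth_over_cy smooth_on_mult[OF M smooth_on_const] smooth_on_add[OF M] smooth_on_mult[OF M] s)
  have "smooth_on M (\<lambda>p. ((1 - \<alpha>) / 2 * (cx (X p) * cx (Y p)) +
      (- (1 + 2 * \<alpha>)) * (cy (X p) * cy (Y p))) / cy p)"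
    by (intro smooth_over_cy smooth_on_add[OF M] smooth_on_mult[OF M smooth_on_const]
        smooth_on_mult[OF M] s)
  then have "smooth_on M (\<lambda>p. ((1 - \<alpha>) / 2 * (cx (X p) * cx (Y p)) -
      (1 + 2 * \<alpha>) * (cy (X p) * cy (Y p))) / cy p)"
    by (simp only: mult_minus_left diff_conv_add_uminus)
  with 1 show ?thesis
    unfolding alpha_christoffel_def
    by (intro smooth_on_add[OF M] smooth_on_scaleR[OF M _ smooth_on_const]) simp_all
qed

lemma bilinear_\<Gamma>: "bilinear (\<Gamma> \<alpha> p)"
  unfolding bilinear_def
  by (intro conjI allI linearI; rule tangent_eqI)
    (simp_all add: subspace_add subspace_scale coordinates_\<Gamma> coordinate_simps algebra_simps
      add_divide_distrib diff_divide_distrib)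

lemma \<Gamma>_commute: "\<Gamma> \<alpha> p u v = \<Gamma> \<alpha> p v u"
  by (simp add: alpha_christoffel_def algebra_simps)

lemma affine_connection_nabla: "affine_connection M (nabla \<alpha>)"
  by (rule affine_connection_christoffel[OF M smooth_\<Gamma> \<Gamma>_tangent bilinear_\<Gamma>])

lemma torsion_free_nabla: "torsion_free M (nabla \<alpha>)"
  by (rule torsion_free_christoffel[OF \<Gamma>_commute])

lemma riemannian_metric: "riemannian_metric M g"
  unfolding riemannian_metric_def
proof (intro conjI ballI allI impI)
  fix p u v w c assume "p \<in> M" "u \<in> tangent M" "v \<in> tangent M" "w \<in> tangent M"
  then show "g p (u + c *\<^sub>R v) w = g p u w + c * g p v w"
    by (simp add: g_eq subspace_add subspace_scale coordinate_simps algebra_simps add_divide_distrib)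
next
  fix p u v assume "p \<in> M" "u \<in> tangent M" "v \<in> tangent M"
  then show "g p u v = g p v u" by (simp add: g_eq mult.commute)
next
  fix p u assume p: "p \<in> M" and u: "u \<in> tangent M" "u \<noteq> 0"
  then have "cx u \<noteq> 0 \<or> cy u \<noteq> 0"
    using tangent_expand[OF u(1)] by auto
  then have "cx u * cx u + 2 * (cy u * cy u) > 0"
    using zero_le_square[of "cx u"] zero_le_square[of "cy u"]
      zero_less_mult_iff[of "cx u" "cx u"] zero_less_mult_iff[of "cy u" "cy u"] by linarith
  then show "g p u u > 0" using p u cy_pos[OF p] by (simp add: g_eq divide_pos_pos)
next
  fix X Y assume X: "X \<in> vector_fields M" and Y: "Y \<in> vector_fields M"
  have "smooth_on M (\<lambda>p. (cx (X p) * cx (Y p) + 2 * (cy (X p) * cy (Y p))) / cy p / cy p)"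
    by (intro smooth_over_cy smooth_on_mult[OF M smooth_on_const] smooth_on_add[OF M]
        smooth_on_mult[OF M] smooth_cx smooth_cy X Y)
  then show "smooth_on M (\<lambda>p. g p (X p) (Y p))"
    by (rule smooth_on_transform[OF _ M])
      (simp add: g_eq vector_fieldsD(3)[OF X] vector_fieldsD(3)[OF Y] power2_eq_square)
qed

text \<open>The derivatives of the components of \<open>Y\<close> and \<open>Z\<close> cancel
  against the flat part of the connection. What remains is the derivative of the factor 1/y^2
  together with the Christoffel terms; their parts free of \<alpha> cancel, and the parts linear in
  \<alpha> add up to the cubic form.\<close>

lemma nabla_metric_nabla:
  assumes X: "X \<in> vector_fields M" and Y: "Y \<in> vector_fields M" and Z: "Z \<in> vector_fields M"
    and p: "p \<in> M"
  shows "nabla_metric g (nabla \<alpha>) X Y Z p = \<alpha> * cubic_form p (X p) (Y p) (Z p)"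
proof -
  obtain Y' where Y': "(Y has_derivative Y') (at p within M)"
    using vector_fieldsD(2)[OF Y] p unfolding differentiable_on_def differentiable_def by blast
  obtain Z' where Z': "(Z has_derivative Z') (at p within M)"
    using vector_fieldsD(2)[OF Z] p unfolding differentiable_on_def differentiable_def by blast
  note tX = vector_fieldsD(3)[OF X p] and tY = vector_fieldsD(3)[OF Y p] and tZ = vector_fieldsD(3)[OF Z p]
  have pos: "cy p > 0" by (rule cy_pos[OF p])
  have dY: "dird Y p (X p) = Y' (X p)" and dZ: "dird Z p (X p) = Z' (X p)"
    by (rule dird_eq[OF M p tX Y'], rule dird_eq[OF M p tX Z'])
  \<comment> \<open>The formula for \<open>g\<close> is available on tangent vectors only, so the
    derivatives of the fields must be known to be tangent before \<open>g\<close> can be evaluated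
    on them.\<close>
  have tdY: "Y' (X p) \<in> tangent M" and tdZ: "Z' (X p) \<in> tangent M"
    using dird_in_subspace[OF M p tX vector_fieldsD(2)[OF Y] subspace_tangent vector_fieldsD(3)[OF Y]]
      dird_in_subspace[OF M p tX vector_fieldsD(2)[OF Z] subspace_tangent vector_fieldsD(3)[OF Z]]
    by (simp_all add: dY dZ)
  note d = bounded_linear.has_derivative[OF cx Y'] bounded_linear.has_derivative[OF cx Z']
    bounded_linear.has_derivative[OF cy Y'] bounded_linear.has_derivative[OF cy Z']
    bounded_linear_imp_has_derivative[OF cy]
  have "((\<lambda>q. (cx (Y q) * cx (Z q) + 2 * (cy (Y q) * cy (Z q))) / (cy q * cy q)) has_derivative
    (\<lambda>h. ((cx (Y p) * cx (Z' h) + cx (Y' h) * cx (Z p)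
          + 2 * (cy (Y p) * cy (Z' h) + cy (Y' h) * cy (Z p))) * (cy p * cy p)
          - (cx (Y p) * cx (Z p) + 2 * (cy (Y p) * cy (Z p))) * (cy p * cy h + cy h * cy p))
        / (cy p * cy p * (cy p * cy p)))) (at p within M)"
    using pos
    by (intro has_derivative_divide' has_derivative_add has_derivative_mult has_derivative_mult_right d) auto
  from dird_eq[OF M p tX this]
  have "dird (\<lambda>q. g q (Y q) (Z q)) p (X p) =
     ((cx (Y p) * cx (Z' (X p)) + cx (Y' (X p)) * cx (Z p)
          + 2 * (cy (Y p) * cy (Z' (X p)) + cy (Y' (X p)) * cy (Z p))) * (cy p * cy p)
          - (cx (Y p) * cx (Z p) + 2 * (cy (Y p) * cy (Z p))) * (cy p * cy (X p) + cy (X p) * cy p))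
        / (cy p * cy p * (cy p * cy p))"
    using dird_cong[OF M p tX, of "\<lambda>q. g q (Y q) (Z q)"
        "\<lambda>q. (cx (Y q) * cx (Z q) + 2 * (cy (Y q) * cy (Z q))) / (cy q * cy q)"]
      vector_fieldsD(3)[OF Y] vector_fieldsD(3)[OF Z]
    by (simp add: g_eq power2_eq_square)
  then show ?thesis
    using X Y Z p pos tX tY tZ tdY tdZ
    by (simp add: nabla_metric_def christoffel_connection_def dY dZ g_eq subspace_add coordinate_simps
        coordinates_\<Gamma> cubic_form_def)
      (simp add: field_simps power2_eq_square power3_eq_cube)
qed

text \<open>This is the equation that characterizes the \<alpha>-connection, once
  \<open>nabla 0\<close> is known to be the Levi-Civita connection. It holds because the symbols are
  affine in \<alpha>, with slope minus one half of the cubic form with an index raised.\<close>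

lemma metric_nabla:
  assumes "X \<in> vector_fields M" "Y \<in> vector_fields M" "Z \<in> vector_fields M" "p \<in> M"
  shows "g p (nabla \<alpha> X Y p) (Z p) = g p (nabla 0 X Y p) (Z p) - \<alpha> / 2 * cubic_form p (X p) (Y p) (Z p)"
proof -
  have t: "dird Y p (X p) \<in> tangent M"
    using assms vector_fieldsD by (intro dird_in_subspace[OF M]) auto
  have pos: "cy p > 0" by (rule cy_pos[OF assms(4)])
  show ?thesis
    using assms t pos vector_fieldsD(3)[OF assms(1,4)] vector_fieldsD(3)[OF assms(2,4)] vector_fieldsD(3)[OF assms(3,4)]
    by (simp add: christoffel_connection_def g_eq subspace_add coordinate_simps coordinates_\<Gamma> cubic_form_def)
      (simp add: field_simps power2_eq_square power3_eq_cube)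
qed

lemma levi_civita: "levi_civita M g = nabla 0"
  by (rule levi_civita_eqI[OF M riemannian_metric affine_connection_nabla torsion_free_nabla])
    (simp add: nabla_metric_nabla)

lemma statistical_manifold: "statistical_manifold M g (nabla \<alpha>)"
  unfolding statistical_manifold_def
  by (auto simp: affine_domain riemannian_metric affine_connection_nabla torsion_free_nabla
      nabla_metric_nabla cubic_form_def algebra_simps)

lemma constant_vector_field: "v \<in> tangent M \<Longrightarrow> (\<lambda>p. if p \<in> M then v else 0) \<in> vector_fields M"
  by (rule vector_fieldsI[OF M smooth_on_const]) auto

text \<open>For \<alpha> = 1 the derivative of the metric is the cubic form, and raising its last
  index gives the stated vector. The coefficients 2 and 8 become 1 and 4 in the direction
  \<open>ay\<close> because the metric weighs that direction by 2.\<close>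

lemma skewness_operator_nabla:
  assumes X: "X \<in> vector_fields M" and Y: "Y \<in> vector_fields M" and p: "p \<in> M"
  shows "skewness_operator M g (nabla 1) X Y p =
    (2 * (cx (X p) * cy (Y p) + cy (X p) * cx (Y p)) / cy p) *\<^sub>R ax +
    ((cx (X p) * cx (Y p) + 4 * (cy (X p) * cy (Y p))) / cy p) *\<^sub>R ay" (is "_ = ?v")
proof -
  have pos: "cy p > 0" by (rule cy_pos[OF p])
  have cv: "cx ?v = 2 * (cx (X p) * cy (Y p) + cy (X p) * cx (Y p)) / cy p"
    "cy ?v = (cx (X p) * cx (Y p) + 4 * (cy (X p) * cy (Y p))) / cy p"
    by (simp_all add: coordinate_simps)
  have v: "\<forall>Z\<in>vector_fields M. g p ?v (Z p) = nabla_metric g (nabla 1) X Y Z p"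
  proof
    fix Z assume Z: "Z \<in> vector_fields M"
    show "g p ?v (Z p) = nabla_metric g (nabla 1) X Y Z p"
      unfolding nabla_metric_nabla[OF X Y Z p]
      using pos by (simp only: g_eq[OF p combination_tangent vector_fieldsD(3)[OF Z p]] cv)
        (simp add: cubic_form_def field_simps power2_eq_square power3_eq_cube)
  qed
  have "(THE v. v \<in> tangent M \<and> (\<forall>Z\<in>vector_fields M. g p v (Z p) = nabla_metric g (nabla 1) X Y Z p)) = ?v"
  proof (rule the_equality)
    fix w assume w: "w \<in> tangent M \<and> (\<forall>Z\<in>vector_fields M. g p w (Z p) = nabla_metric g (nabla 1) X Y Z p)"
    \<comment> \<open>Every tangent vector at \<open>p\<close> is the value of a constant field on
      \<open>M\<close> extended by 0, so testing on fields amounts to testing on vectors. The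
      choices \<open>ax\<close> and \<open>ay\<close> then read off the two coordinates.\<close>
    have eq: "g p w z = g p ?v z" if "z \<in> tangent M" for z
      using w v constant_vector_field[OF that] p by fastforce
    show "w = ?v"
      using eq[of ax] eq[of ay] w pos p
      by (intro tangent_eqI) (simp_all add: g_eq)
  qed (use v in simp)
  then show ?thesis using p by (simp add: skewness_operator_def)
qed

section \<open>The orthonormal frame in coordinates\<close>

definition frame_x where "frame_x p = (if p \<in> M then cy p *\<^sub>R ax else 0)"
definition frame_y where "frame_y p = (if p \<in> M then (cy p / sqrt 2) *\<^sub>R ay else 0)"

lemma frame_x_vector_field: "frame_x \<in> vector_fields M"
  by (rule vector_fieldsI[OF M smooth_on_scaleR[OF M smooth_on_linear[OF cy] smooth_on_const]])
    (auto simp: frame_x_def subspace_scale)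

lemma frame_y_vector_field: "frame_y \<in> vector_fields M"
proof (rule vector_fieldsI[OF M])
  show "smooth_on M (\<lambda>p. cy p *\<^sub>R ((1 / sqrt 2) *\<^sub>R ay))"
    by (rule smooth_on_scaleR[OF M smooth_on_linear[OF cy] smooth_on_const])
qed (auto simp: frame_y_def subspace_scale)

lemma coordinates_frame:
  assumes "p \<in> M"
  shows "cx (frame_x p) = cy p" "cy (frame_x p) = 0" "cx (frame_y p) = 0" "cy (frame_y p) = cy p / sqrt 2"
  using assms by (simp_all add: frame_x_def frame_y_def coordinate_simps)

lemma orthonormal_frame: "orthonormal_frame M g frame_x frame_y"
  unfolding orthonormal_frame_def
proof (intro conjI ballI frame_x_vector_field frame_y_vector_field)
  fix p assume p: "p \<in> M"
  have pos: "cy p > 0" by (rule cy_pos[OF p])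
  have t: "frame_x p \<in> tangent M" "frame_y p \<in> tangent M"
    using p vector_fieldsD(3) frame_x_vector_field frame_y_vector_field by auto
  show "g p (frame_x p) (frame_x p) = 1" "g p (frame_x p) (frame_y p) = 0" "g p (frame_y p) (frame_y p) = 1"
    using pos by (simp_all add: g_eq[OF p] t coordinates_frame[OF p] power2_eq_square)
  have "ax = (1 / cy p) *\<^sub>R frame_x p" "ay = (sqrt 2 / cy p) *\<^sub>R frame_y p"
    using p pos by (simp_all add: frame_x_def frame_y_def)
  then have "ax \<in> span {frame_x p, frame_y p}" "ay \<in> span {frame_x p, frame_y p}"
    by (metis insertI1 insertI2 span_base span_scale)+
  then have "tangent M \<subseteq> span {frame_x p, frame_y p}"
    unfolding tangent_eq by (intro span_minimal) auto
  moreover have "span {frame_x p, frame_y p} \<subseteq> tangent M"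
    using t by (intro span_minimal) auto
  ultimately show "span {frame_x p, frame_y p} = tangent M" by blast
qed

lemma dird_frame:
  assumes p: "p \<in> M" and v: "v \<in> tangent M"
  shows "dird frame_x p v = cy v *\<^sub>R ax" "dird frame_y p v = (cy v / sqrt 2) *\<^sub>R ay"
proof -
  have b: "bounded_linear (\<lambda>q. cy q *\<^sub>R ax)" "bounded_linear (\<lambda>q. cy q *\<^sub>R ((1 / sqrt 2) *\<^sub>R ay))"
    by (rule bounded_linear_compose[OF bounded_linear_scaleR_left cy])+
  have "dird frame_x p v = dird (\<lambda>q. 0 + cy q *\<^sub>R ax) p v"
    by (rule dird_cong[OF M p v]) (simp add: frame_x_def)
  then show "dird frame_x p v = cy v *\<^sub>R ax" by (simp only: dird_affine[OF b(1)])
  have "dird frame_y p v = dird (\<lambda>q. 0 + cy q *\<^sub>R ((1 / sqrt 2) *\<^sub>R ay)) p v"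
    by (rule dird_cong[OF M p v]) (simp add: frame_y_def)
  then show "dird frame_y p v = (cy v / sqrt 2) *\<^sub>R ay" by (simp only: dird_affine[OF b(2)]) simp
qed

text \<open>The frame fields scale with y, so differentiating them in the direction
  \<open>frame_y\<close> adds a flat term to the Christoffel term. For \<open>frame_y\<close>,
  \<open>frame_x\<close> this term is \<open>frame_x / sqrt 2\<close>, which turns the factor -(1 +
  \<alpha>) into -\<alpha> and accounts for the asymmetry between the two mixed derivatives.\<close>

lemma nabla_frame:
  "nabla \<alpha> frame_x frame_x = (\<lambda>p. ((1 - \<alpha>) / sqrt 2) *\<^sub>R frame_y p)" (is ?xx)
  "nabla \<alpha> frame_x frame_y = (\<lambda>p. (- ((1 + \<alpha>) / sqrt 2)) *\<^sub>R frame_x p)" (is ?xy)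
  "nabla \<alpha> frame_y frame_x = (\<lambda>p. (- (\<alpha> / sqrt 2)) *\<^sub>R frame_x p)" (is ?yx)
  "nabla \<alpha> frame_y frame_y = (\<lambda>p. (- (2 * \<alpha> / sqrt 2)) *\<^sub>R frame_y p)" (is ?yy)
proof -
  note vf = frame_x_vector_field frame_y_vector_field
  have *: "nabla \<alpha> U V = W"
    if U: "U \<in> vector_fields M" and V: "V \<in> vector_fields M" and W: "W \<in> vector_fields M"
      and x: "\<And>p. p \<in> M \<Longrightarrow> cx (dird V p (U p) + \<Gamma> \<alpha> p (U p) (V p)) = cx (W p)"
      and y: "\<And>p. p \<in> M \<Longrightarrow> cy (dird V p (U p) + \<Gamma> \<alpha> p (U p) (V p)) = cy (W p)" for U V W
  proof
    fix p
    have N: "nabla \<alpha> U V \<in> vector_fields M"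
      by (rule affine_connection_vector_fields[OF affine_connection_nabla U V])
    show "nabla \<alpha> U V p = W p"
    proof (cases "p \<in> M")
      case True
      show ?thesis
        by (rule tangent_eqI[OF vector_fieldsD(3)[OF N True] vector_fieldsD(3)[OF W True]])
          (use U V True x y in \<open>simp_all add: christoffel_connection_def\<close>)
    qed (simp add: vector_fieldsD(4)[OF N] vector_fieldsD(4)[OF W])
  qed
  have t: "frame_x p \<in> tangent M" "frame_y p \<in> tangent M" if "p \<in> M" for p
    using that vector_fieldsD(3) vf by auto
  have pos: "cy p \<noteq> 0" if "p \<in> M" for p using cy_pos[OF that] by simp
  note simps = coordinate_simps coordinates_\<Gamma> dird_frame t coordinates_frame
  show ?xx
    by (rule *[OF vf(1,1) vector_fields_scaleR[OF M vf(2) smooth_on_const]])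
      (simp_all add: simps pos field_simps)
  show ?xy
    by (rule *[OF vf(1,2) vector_fields_scaleR[OF M vf(1) smooth_on_const]])
      (simp_all add: simps pos field_simps)
  show ?yx
    by (rule *[OF vf(2,1) vector_fields_scaleR[OF M vf(1) smooth_on_const]])
      (simp_all add: simps pos field_simps)
  show ?yy
    by (rule *[OF vf(2,2) vector_fields_scaleR[OF M vf(2) smooth_on_const]])
      (simp_all add: simps pos field_simps)
qed

lemma skewness_frame:
  "skewness_operator M g (nabla 1) frame_x frame_x = (\<lambda>p. sqrt 2 *\<^sub>R frame_y p)" (is ?xx)
  "skewness_operator M g (nabla 1) frame_x frame_y = (\<lambda>p. sqrt 2 *\<^sub>R frame_x p)" (is ?xy)
  "skewness_operator M g (nabla 1) frame_y frame_y = (\<lambda>p. (2 * sqrt 2) *\<^sub>R frame_y p)" (is ?yy)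
proof -
  have *: "skewness_operator M g (nabla 1) U V = W"
    if "\<And>p. p \<in> M \<Longrightarrow> skewness_operator M g (nabla 1) U V p = W p" "\<And>p. p \<notin> M \<Longrightarrow> W p = 0" for U V W
    using that by (auto simp: fun_eq_iff skewness_operator_def)
  note vf = frame_x_vector_field frame_y_vector_field
  have pos: "cy p \<noteq> 0" if "p \<in> M" for p using cy_pos[OF that] by simp
  have s: "2 / sqrt 2 = sqrt 2" by (simp add: real_div_sqrt)
  show ?xx ?xy ?yy
    by (rule *; simp add: skewness_operator_nabla vf coordinates_frame pos;
        simp add: frame_x_def frame_y_def pos s field_simps)+
qed

end

section \<open>Fisher metric and cubic form of the normal distributions\<close>

lemma half_plane_iff: "p \<in> half_plane \<longleftrightarrow> snd p > 0"
  by (cases p) (simp add: half_plane_def)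

lemma open_half_plane: "open half_plane"
proof -
  have "half_plane = {p. 0 < snd p}" by (auto simp: half_plane_iff)
  also have "open \<dots>" by (intro open_Collect_less continuous_intros)
  finally show ?thesis .
qed

lemma affine_domain_half_plane: "affine_domain half_plane"
proof -
  have "(0, 1) \<in> half_plane" by (simp add: half_plane_iff)
  then show ?thesis
    unfolding affine_domain_def
    using open_subset[OF hull_subset open_half_plane, of affine] by auto
qed

lemma tangent_half_plane: "tangent half_plane = span {(1, 0), (0, 1)}"
proof -
  have "u \<in> span {(1, 0), (0, 1)}" for u :: "real \<times> real"
  proof -
    have "u = fst u *\<^sub>R (1, 0) + snd u *\<^sub>R (0, 1)" by (cases u) simp
    moreover have "fst u *\<^sub>R (1, 0) + snd u *\<^sub>R (0, 1) \<in> span {(1, 0), (0, 1) :: real \<times> real}"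
      by (intro span_add span_scale span_base) auto
    ultimately show ?thesis by simp
  qed
  moreover have "{(1, 0), (0, 1)} \<subseteq> tangent half_plane"
    using diff_in_tangent[of "(1, 1)" half_plane "(0, 1)"] diff_in_tangent[of "(0, 2)" half_plane "(0, 1)"]
    by (simp add: half_plane_iff)
  then have "span {(1, 0), (0, 1)} \<subseteq> tangent half_plane"
    by (intro span_minimal) auto
  ultimately show ?thesis by blast
qed

text \<open>In terms of the standardized variable z = (t - \<mu>)/\<sigma>, the scores are the
  Hermite polynomials z and z^2 - 1 divided by \<sigma>. All later expectations thus become moments
  of a standard normal variable.\<close>

lemma score_eq:
  assumes "\<theta> \<in> half_plane"
  shows "score \<theta> u t = (fst u * ((t - fst \<theta>) / snd \<theta>) + snd u * (((t - fst \<theta>) / snd \<theta>)\<^sup>2 - 1)) / snd \<theta>"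
proof -
  have pos: "snd \<theta> > 0" using assms by (simp add: half_plane_iff)
  define h where "h s = - ln (sqrt (2 * pi)) - ln (snd \<theta> + s * snd u)
      - (t - (fst \<theta> + s * fst u))\<^sup>2 / (2 * (snd \<theta> + s * snd u)\<^sup>2)" for s
  have h: "ln (normal_density \<mu> \<sigma> t) = - ln (sqrt (2 * pi)) - ln \<sigma> - (t - \<mu>)\<^sup>2 / (2 * \<sigma>\<^sup>2)"
    if "\<sigma> > 0" for \<mu> \<sigma>
  proof -
    have "normal_density \<mu> \<sigma> t = exp (- (t - \<mu>)\<^sup>2 / (2 * \<sigma>\<^sup>2)) / (sqrt (2 * pi) * \<sigma>)"
      using that by (simp add: normal_density_def real_sqrt_mult)
    also have "ln \<dots> = - (t - \<mu>)\<^sup>2 / (2 * \<sigma>\<^sup>2) - ln (sqrt (2 * pi) * \<sigma>)"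
      using that by (subst ln_div) auto
    also have "ln (sqrt (2 * pi) * \<sigma>) = ln (sqrt (2 * pi)) + ln \<sigma>"
      using that by (intro ln_mult_pos) auto
    finally show ?thesis by simp
  qed
  \<comment> \<open>The logarithm of the density splits as in \<open>h\<close> for positive standard
    deviation, which holds along the line only for small \<open>s\<close>. This suffices for the
    derivative at 0.\<close>
  have "((\<lambda>s. snd \<theta> + s * snd u) \<longlongrightarrow> snd \<theta> + 0 * snd u) (nhds 0)"
    by (intro tendsto_intros filterlim_ident)
  then have "\<forall>\<^sub>F s in nhds 0. snd \<theta> + s * snd u > 0"
    using pos by (intro order_tendstoD) auto
  then have "\<forall>\<^sub>F s in nhds 0. s \<in> UNIV \<longrightarrow>
      ln (normal_density (fst (\<theta> + s *\<^sub>R u)) (snd (\<theta> + s *\<^sub>R u)) t) = h s"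
    by eventually_elim (simp add: h h_def)
  then have "score \<theta> u t = vector_derivative h (at 0)"
    unfolding score_def dird_def by (rule vector_derivative_cong_eq) auto
  also have "(h has_real_derivative
      (fst u * ((t - fst \<theta>) / snd \<theta>) + snd u * (((t - fst \<theta>) / snd \<theta>)\<^sup>2 - 1)) / snd \<theta>) (at 0)"
    unfolding h_def using pos
    by (auto intro!: derivative_eq_intros simp: field_simps power2_eq_square)
  then have "vector_derivative h (at 0) =
      (fst u * ((t - fst \<theta>) / snd \<theta>) + snd u * (((t - fst \<theta>) / snd \<theta>)\<^sup>2 - 1)) / snd \<theta>"
    by (simp add: has_real_derivative_iff_has_vector_derivative vector_derivative_at)
  finally show ?thesis .
qed

text \<open>Dividing the central moment by the n-th power of the standard deviation removes the
  dependence on \<theta>; the even values are the double factorials 1, 1, 3, 15. Stating it with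
  \<open>has_bochner_integral\<close> keeps integrability at hand for sums.\<close>

lemma expectation_standardized_power:
  assumes "\<theta> \<in> half_plane"
  shows "has_bochner_integral lborel
    (\<lambda>t. ((t - fst \<theta>) / snd \<theta>) ^ n * normal_density (fst \<theta>) (snd \<theta>) t)
    (if even n then fact n / (2 ^ (n div 2) * fact (n div 2)) else 0)"
proof -
  have pos: "snd \<theta> > 0" using assms by (simp add: half_plane_iff)
  have *: "((t - fst \<theta>) / snd \<theta>) ^ n * normal_density (fst \<theta>) (snd \<theta>) t =
      (1 / snd \<theta> ^ n) * (normal_density (fst \<theta>) (snd \<theta>) t * (t - fst \<theta>) ^ n)" for t
    by (simp add: power_divide)
  show ?thesis
  proof (cases "even n")
    case True
    then obtain k where k: "n = 2 * k" by (auto elim: evenE)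
    have "(1 / snd \<theta> ^ n) * (fact (2 * k) / ((2 / (snd \<theta>)\<^sup>2) ^ k * fact k)) = fact n / (2 ^ k * fact k)"
      using pos by (simp add: k power_mult power_divide)
    with True have c: "(1 / snd \<theta> ^ n) * (fact (2 * k) / ((2 / (snd \<theta>)\<^sup>2) ^ k * fact k)) =
        (if even n then fact n / (2 ^ (n div 2) * fact (n div 2)) else 0)"
      by (simp add: k)
    then show ?thesis
      using has_bochner_integral_mult_right[OF normal_moment_even[OF pos, of "fst \<theta>" k], of "1 / snd \<theta> ^ n"]
      unfolding * c by (simp only: k)
  next
    case False
    then obtain k where k: "n = 2 * k + 1" by (auto elim: oddE)
    then show ?thesis
      using has_bochner_integral_mult_right[OF normal_moment_odd[OF pos, of "fst \<theta>" k], of "1 / snd \<theta> ^ n"]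
      unfolding * by simp
  qed
qed

lemma sum_atMost_6:
  fixes f :: "nat \<Rightarrow> real"
  shows "(\<Sum>n\<le>6. f n) = f 0 + f 1 + f 2 + f 3 + f 4 + f 5 + f 6"
proof -
  have "{..6} = {0, 1, 2, 3, 4, 5, 6 :: nat}" by auto
  then show ?thesis by simp
qed

text \<open>Degree 6 is that of a product of three scores, each quadratic in the standardized
  variable; the weights are the even moments up to order six.\<close>

lemma expectation_standardized_polynomial:
  assumes "\<theta> \<in> half_plane" "\<And>t. f t = (\<Sum>n\<le>6. a n * ((t - fst \<theta>) / snd \<theta>) ^ n)"
  shows "expectation_at \<theta> f = a 0 + a 2 + 3 * a 4 + 15 * a 6"
proof -
  have "has_bochner_integral lborel
      (\<lambda>t. \<Sum>n\<le>6. a n * (((t - fst \<theta>) / snd \<theta>) ^ n * normal_density (fst \<theta>) (snd \<theta>) t))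
      (\<Sum>n\<le>6. a n * (if even n then fact n / (2 ^ (n div 2) * fact (n div 2)) else 0))"
    by (intro has_bochner_integral_sum has_bochner_integral_mult_right expectation_standardized_power assms)
  moreover have "f t * normal_density (fst \<theta>) (snd \<theta>) t =
      (\<Sum>n\<le>6. a n * (((t - fst \<theta>) / snd \<theta>) ^ n * normal_density (fst \<theta>) (snd \<theta>) t))" for t
    by (simp add: assms(2) sum_distrib_right mult.assoc)
  ultimately have "expectation_at \<theta> f =
      (\<Sum>n\<le>6. a n * (if even n then fact n / (2 ^ (n div 2) * fact (n div 2)) else 0))"
    by (simp add: expectation_at_def has_bochner_integral_integral_eq)
  also have "\<dots> = a 0 + a 2 + 3 * a 4 + 15 * a 6"
    by (simp add: sum_atMost_6 fact_numeral)
  finally show ?thesis .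
qed

lemma fisher_metric_eq:
  assumes "p \<in> half_plane"
  shows "fisher_metric p u v = (fst u * fst v + 2 * (snd u * snd v)) / (snd p)\<^sup>2"
proof -
  have pos: "snd p > 0" using assms by (simp add: half_plane_iff)
  obtain u1 u2 v1 v2 where uv: "u = (u1, u2)" "v = (v1, v2)" by (metis surj_pair)
  \<comment> \<open>The coefficients, by increasing powers of z, of the product of u1 z + u2 (z^2 -
    1) and v1 z + v2 (z^2 - 1), padded with zeros up to degree 6.\<close>
  define a where "a = (\<lambda>n. [u2 * v2, -(u1 * v2 + u2 * v1), u1 * v1 - 2 * u2 * v2, u1 * v2 + u2 * v1, u2 * v2, 0, 0] ! n / (snd p)\<^sup>2)"
  have "score p u t * score p v t = (\<Sum>n\<le>6. a n * ((t - fst p) / snd p) ^ n)" for t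
  proof -
    define z where "z = (t - fst p) / snd p"
    show ?thesis
      unfolding score_eq[OF assms] uv a_def z_def[symmetric] sum_atMost_6
      using pos by (simp add: field_simps power2_eq_square eval_nat_numeral)
  qed
  from expectation_standardized_polynomial[OF assms this]
  show ?thesis
    by (simp add: fisher_metric_def a_def uv add_divide_distrib diff_divide_distrib)
qed

lemma amari_chentsov_eq:
  assumes "p \<in> half_plane"
  shows "amari_chentsov p u v w =
    (2 * (fst u * fst v * snd w + fst u * snd v * fst w + snd u * fst v * fst w)
      + 8 * (snd u * snd v * snd w)) / (snd p) ^ 3"
proof -
  have pos: "snd p > 0" using assms by (simp add: half_plane_iff)
  obtain u1 u2 v1 v2 w1 w2 where uv: "u = (u1, u2)" "v = (v1, v2)" "w = (w1, w2)" by (metis surj_pair)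
  \<comment> \<open>With h = z^2 - 1 the triple product is u1 v1 w1 z^3 + q z^2 h + l z h^2 + c h^3.
    Expanding the powers of h gives the list below, and the moments turn it into 2 q + 8 c.\<close>
  define l where "l = u1 * v2 * w2 + u2 * v1 * w2 + u2 * v2 * w1"
  define q where "q = u1 * v1 * w2 + u1 * v2 * w1 + u2 * v1 * w1"
  define c where "c = u2 * v2 * w2"
  define a where "a = (\<lambda>n. [- c, l, 3 * c - q, u1 * v1 * w1 - 2 * l, q - 3 * c, l, c] ! n / (snd p)^3)"
  have "score p u t * score p v t * score p w t = (\<Sum>n\<le>6. a n * ((t - fst p) / snd p) ^ n)" for t
  proof -
    define z where "z = (t - fst p) / snd p"
    show ?thesis
      unfolding score_eq[OF assms] uv a_def z_def[symmetric] sum_atMost_6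
      using pos by (simp add: field_simps eval_nat_numeral l_def q_def c_def)
  qed
  from expectation_standardized_polynomial[OF assms this]
  show ?thesis
    using pos
    by (simp add: amari_chentsov_def a_def uv)
      (simp add: field_simps l_def q_def c_def)
qed

lemma half_plane_model_normal: "half_plane_model half_plane fst snd (1, 0) (0, 1) fisher_metric"
proof (rule half_plane_model.intro)
  show "tangent half_plane = span {(1, 0), (0, 1)}"
    by (rule tangent_half_plane)
  show "fisher_metric p u v = (fst u * fst v + 2 * (snd u * snd v)) / (snd p)\<^sup>2"
    if "p \<in> half_plane" for p u v
    using that by (rule fisher_metric_eq)
  show "0 < snd p" if "p \<in> half_plane" for p
    using that by (simp add: half_plane_iff)
qed (simp_all only: affine_domain_half_plane bounded_linear_fst bounded_linear_snd fst_conv snd_conv)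

interpretation normal: half_plane_model half_plane fst snd "(1, 0)" "(0, 1)" fisher_metric
  by (rule half_plane_model_normal)

text \<open>The description prescribes the inner product of \<open>D X Y\<close> with every test
  field, so \<open>affine_connection_eqI\<close> gives uniqueness. Existence is
  \<open>normal.metric_nabla\<close>, because the Gaussian moments identify the abstract cubic form
  with \<open>amari_chentsov\<close>.\<close>

lemma alpha_connection_eq: "alpha_connection \<alpha> = normal.nabla \<alpha>"
  unfolding alpha_connection_def
proof (rule the_equality)
  show *: "affine_connection half_plane (normal.nabla \<alpha>) \<and>
    (\<forall>X\<in>vector_fields half_plane. \<forall>Y\<in>vector_fields half_plane. \<forall>Z\<in>vector_fields half_plane. \<forall>p\<in>half_plane.
      fisher_metric p (normal.nabla \<alpha> X Y p) (Z p) =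
        fisher_metric p (levi_civita half_plane fisher_metric X Y p) (Z p)
        - \<alpha> / 2 * amari_chentsov p (X p) (Y p) (Z p))"
    by (intro conjI ballI normal.affine_connection_nabla, subst normal.metric_nabla)
      (simp_all add: normal.levi_civita amari_chentsov_eq normal.cubic_form_def)
  fix D assume "affine_connection half_plane D \<and>
    (\<forall>X\<in>vector_fields half_plane. \<forall>Y\<in>vector_fields half_plane. \<forall>Z\<in>vector_fields half_plane. \<forall>p\<in>half_plane.
      fisher_metric p (D X Y p) (Z p) =
        fisher_metric p (levi_civita half_plane fisher_metric X Y p) (Z p)
        - \<alpha> / 2 * amari_chentsov p (X p) (Y p) (Z p))"
  then show "D = normal.nabla \<alpha>"
    using * by (intro affine_connection_eqI[OF normal.M normal.riemannian_metric]) simp_all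
qed

section \<open>The matrix group\<close>

lemma to_matrix_nth [simp]:
  "to_matrix \<theta> $ 1 $ 1 = snd \<theta>" "to_matrix \<theta> $ 1 $ 2 = fst \<theta>"
  "to_matrix \<theta> $ 2 $ 1 = 0" "to_matrix \<theta> $ 2 $ 2 = 1"
  by (simp_all add: to_matrix_def)

lemma E1_nth [simp]: "E1 $ 1 $ 1 = 0" "E1 $ 1 $ 2 = 1" "E1 $ 2 $ i = 0"
  using exhaust_2[of i] by (auto simp: E1_def)

lemma E2_nth [simp]: "E2 $ 1 $ 1 = 1" "E2 $ 1 $ 2 = 0" "E2 $ 2 $ i = 0"
  using exhaust_2[of i] by (auto simp: E2_def)

lemma matrix_2_eq_iff:
  fixes A B :: "real^2^2"
  shows "A = B \<longleftrightarrow> A $ 1 $ 1 = B $ 1 $ 1 \<and> A $ 1 $ 2 = B $ 1 $ 2 \<and>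
    A $ 2 $ 1 = B $ 2 $ 1 \<and> A $ 2 $ 2 = B $ 2 $ 2"
  by (auto simp: vec_eq_iff forall_2)

lemma matrix_mult_nth_2:
  fixes A B :: "real^2^2"
  shows "(A ** B) $ i $ j = A $ i $ 1 * B $ 1 $ j + A $ i $ 2 * B $ 2 $ j"
  by (simp add: matrix_matrix_mult_def sum_2)

lemma bounded_bilinear_matrix_mult: "bounded_bilinear ((**) :: real^2^2 \<Rightarrow> real^2^2 \<Rightarrow> real^2^2)"
  unfolding bilinear_conv_bounded_bilinear[symmetric] bilinear_def
  by (auto intro!: linearI simp: matrix_2_eq_iff matrix_mult_nth_2 algebra_simps)

lemma bounded_linear_nth_nth: "bounded_linear (\<lambda>A::real^2^2. A $ i $ j)"
  by (rule bounded_linear_compose[OF bounded_linear_vec_nth bounded_linear_vec_nth])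

lemma matrix_group_simps [simp]:
  "mult matrix_group = (**)" "one matrix_group = mat 1"
  by (simp_all add: matrix_group_def)

lemma mem_matrix_group_iff:
  "A \<in> carrier matrix_group \<longleftrightarrow> A $ 1 $ 1 > 0 \<and> A $ 2 $ 1 = 0 \<and> A $ 2 $ 2 = 1"
proof
  assume "A $ 1 $ 1 > 0 \<and> A $ 2 $ 1 = 0 \<and> A $ 2 $ 2 = 1"
  then have "A = vector [vector [A $ 1 $ 1, A $ 1 $ 2], vector [0, 1]]" "A $ 1 $ 1 > 0"
    by (auto simp: matrix_2_eq_iff)
  then show "A \<in> carrier matrix_group" unfolding matrix_group_def by auto
qed (auto simp: matrix_group_def)

lemma group_matrix_group: "group matrix_group"
proof (rule groupI)
  fix A assume A: "A \<in> carrier matrix_group"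
  \<comment> \<open>A group element acts as the affine map t to y t + x of the line; the witness is
    the matrix of the inverse map t to (t - x)/y.\<close>
  then have "to_matrix (- (A $ 1 $ 2 / A $ 1 $ 1), 1 / A $ 1 $ 1) \<in> carrier matrix_group"
    "to_matrix (- (A $ 1 $ 2 / A $ 1 $ 1), 1 / A $ 1 $ 1) \<otimes>\<^bsub>matrix_group\<^esub> A = \<one>\<^bsub>matrix_group\<^esub>"
    by (auto simp: mem_matrix_group_iff matrix_2_eq_iff matrix_mult_nth_2 mat_def field_simps)
  then show "\<exists>B\<in>carrier matrix_group. B \<otimes>\<^bsub>matrix_group\<^esub> A = \<one>\<^bsub>matrix_group\<^esub>" by blast
qed (auto simp: mem_matrix_group_iff matrix_mult_nth_2 matrix_2_eq_iff mat_def algebra_simps)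

interpretation G: group matrix_group
  rewrites "mult matrix_group = (**)" and "one matrix_group = mat 1"
  by (rule group_matrix_group) simp_all

lemma inv_matrix_group:
  assumes "A \<in> carrier matrix_group"
  shows "inv\<^bsub>matrix_group\<^esub> A = to_matrix (- (A $ 1 $ 2 / A $ 1 $ 1), 1 / A $ 1 $ 1)"
  by (rule G.inv_equality)
    (use assms in \<open>auto simp: mem_matrix_group_iff matrix_2_eq_iff matrix_mult_nth_2 mat_def field_simps\<close>)

lemma affine_domain_matrix_group: "affine_domain (carrier matrix_group)"
proof -
  let ?S = "{A::real^2^2. A $ 2 $ 1 = 0 \<and> A $ 2 $ 2 = 1}"
  have "affine ?S" by (auto simp: affine_def simp flip: distrib_right)
  moreover have "carrier matrix_group \<subseteq> ?S" by (auto simp: mem_matrix_group_iff)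
  ultimately have "affine hull carrier matrix_group \<subseteq> ?S" by (rule hull_minimal[rotated])
  \<comment> \<open>Inside the plane \<open>?S\<close> the group is cut out by the open condition
    that the first entry be positive. Bounding the hull by \<open>?S\<close> already yields relative
    openness.\<close>
  then have "carrier matrix_group = affine hull carrier matrix_group \<inter> {A. 0 < A $ 1 $ 1}"
    using hull_subset[of "carrier matrix_group" affine] by (auto simp: mem_matrix_group_iff)
  moreover have "open {A::real^2^2. 0 < A $ 1 $ 1}"
    by (intro open_Collect_less continuous_intros linear_continuous_on bounded_linear_nth_nth)
  ultimately show ?thesis
    unfolding affine_domain_def openin_open using G.one_closed by blast
qed

lemma tangent_matrix_group: "tangent (carrier matrix_group) = span {E1, E2}"
proof
  have "p - q \<in> span {E1, E2}" if "p \<in> carrier matrix_group" "q \<in> carrier matrix_group" for p q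
  proof -
    have "p - q = (p - q) $ 1 $ 2 *\<^sub>R E1 + (p - q) $ 1 $ 1 *\<^sub>R E2"
      using that by (simp add: mem_matrix_group_iff matrix_2_eq_iff)
    moreover have "(p - q) $ 1 $ 2 *\<^sub>R E1 + (p - q) $ 1 $ 1 *\<^sub>R E2 \<in> span {E1, E2}"
      by (intro span_add span_scale span_base) auto
    ultimately show ?thesis by metis
  qed
  then show "tangent (carrier matrix_group) \<subseteq> span {E1, E2}"
    unfolding tangent_def by (intro span_minimal) auto
  have "E1 = to_matrix (1, 1) - to_matrix (0, 1)" "E2 = to_matrix (0, 2) - to_matrix (0, 1)"
    by (simp_all add: matrix_2_eq_iff)
  then have "E1 \<in> tangent (carrier matrix_group)" "E2 \<in> tangent (carrier matrix_group)"
    using diff_in_tangent[of "to_matrix (1, 1)" "carrier matrix_group" "to_matrix (0, 1)"]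
      diff_in_tangent[of "to_matrix (0, 2)" "carrier matrix_group" "to_matrix (0, 1)"]
    by (simp_all add: mem_matrix_group_iff)
  then show "span {E1, E2} \<subseteq> tangent (carrier matrix_group)"
    by (intro span_minimal) auto
qed

lemma half_plane_model_matrix_group:
  "half_plane_model (carrier matrix_group) (\<lambda>A. A $ 1 $ 2) (\<lambda>A. A $ 1 $ 1) E1 E2 matrix_metric"
proof (rule half_plane_model.intro)
  show "tangent (carrier matrix_group) = span {E1, E2}"
    by (rule tangent_matrix_group)
  show "0 < A $ 1 $ 1" if "A \<in> carrier matrix_group" for A
    using that by (simp add: mem_matrix_group_iff)
  show "matrix_metric p u v = (u $ 1 $ 2 * v $ 1 $ 2 + 2 * (u $ 1 $ 1 * v $ 1 $ 1)) / (p $ 1 $ 1)\<^sup>2" for p u v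
    by (rule matrix_metric_def)
qed (simp_all only: affine_domain_matrix_group bounded_linear_nth_nth E1_nth E2_nth)

interpretation matrix: half_plane_model "carrier matrix_group"
    "\<lambda>A. A $ 1 $ 2" "\<lambda>A. A $ 1 $ 1" E1 E2 matrix_metric
  by (rule half_plane_model_matrix_group)

lemma tangent_matrix_group_nth:
  assumes "u \<in> tangent (carrier matrix_group)" shows "u $ 2 $ i = 0"
proof -
  have "u = u $ 1 $ 2 *\<^sub>R E1 + u $ 1 $ 1 *\<^sub>R E2" by (rule matrix.tangent_expand[OF assms])
  then have "u $ 2 $ i = (u $ 1 $ 2 *\<^sub>R E1 + u $ 1 $ 1 *\<^sub>R E2) $ 2 $ i" by simp
  then show ?thesis by simp
qed

text \<open>The translation part \<open>to_matrix 0\<close> is not a group element, its first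
  diagonal entry being 0; it supplies the constant second row.\<close>

lemma affine_isomorphism_to_matrix:
  "affine_isomorphism half_plane (carrier matrix_group)
     to_matrix (to_matrix 0) (\<lambda>\<theta>. fst \<theta> *\<^sub>R E1 + snd \<theta> *\<^sub>R E2)
     (\<lambda>A. (A $ 1 $ 2, A $ 1 $ 1)) 0 (\<lambda>A. (A $ 1 $ 2, A $ 1 $ 1))"
proof (rule affine_isomorphism.intro[OF normal.M matrix.M])
  show "bounded_linear (\<lambda>\<theta>. fst \<theta> *\<^sub>R E1 + snd \<theta> *\<^sub>R E2)"
    by (intro bounded_linear_add bounded_linear_compose[OF bounded_linear_scaleR_left]
        bounded_linear_fst bounded_linear_snd)
  show "bounded_linear (\<lambda>A::real^2^2. (A $ 1 $ 2, A $ 1 $ 1))"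
    by (intro bounded_linear_Pair bounded_linear_nth_nth)
qed (auto simp: fun_eq_iff mem_matrix_group_iff half_plane_iff matrix_2_eq_iff)

interpretation to_matrix: affine_isomorphism half_plane "carrier matrix_group"
    to_matrix "to_matrix 0" "\<lambda>\<theta>. fst \<theta> *\<^sub>R E1 + snd \<theta> *\<^sub>R E2"
    "\<lambda>A. (A $ 1 $ 2, A $ 1 $ 1)" 0 "\<lambda>A. (A $ 1 $ 2, A $ 1 $ 1)"
  by (rule affine_isomorphism_to_matrix)

lemma \<Gamma>_to_matrix:
  "matrix.\<Gamma> \<alpha> (to_matrix p) (fst u *\<^sub>R E1 + snd u *\<^sub>R E2) (fst v *\<^sub>R E1 + snd v *\<^sub>R E2) =
    fst (normal.\<Gamma> \<alpha> p u v) *\<^sub>R E1 + snd (normal.\<Gamma> \<alpha> p u v) *\<^sub>R E2"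
  by (simp add: alpha_christoffel_def)

lemma matrix_connection_eq: "matrix_connection \<alpha> = matrix.nabla \<alpha>"
  unfolding matrix_connection_def alpha_connection_eq
  by (rule to_matrix.transport_christoffel) (rule \<Gamma>_to_matrix)

section \<open>Left translations and left invariance\<close>

lemma affine_isomorphism_left_translation:
  assumes a: "a \<in> carrier matrix_group"
  shows "affine_isomorphism (carrier matrix_group) (carrier matrix_group)
    ((**) a) 0 ((**) a) ((**) (inv\<^bsub>matrix_group\<^esub> a)) 0 ((**) (inv\<^bsub>matrix_group\<^esub> a))"
proof (rule affine_isomorphism.intro[OF matrix.M matrix.M])
  show "bounded_linear ((**) a :: real^2^2 \<Rightarrow> _)"
    by (rule bounded_bilinear.bounded_linear_right[OF bounded_bilinear_matrix_mult])
  show "bounded_linear ((**) (inv\<^bsub>matrix_group\<^esub> a) :: real^2^2 \<Rightarrow> _)"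
    by (rule bounded_bilinear.bounded_linear_right[OF bounded_bilinear_matrix_mult])
  fix p assume p: "p \<in> carrier matrix_group"
  show "a ** p \<in> carrier matrix_group" "inv\<^bsub>matrix_group\<^esub> a ** p \<in> carrier matrix_group"
    using a p by simp_all
  show "inv\<^bsub>matrix_group\<^esub> a ** (a ** p) = p" "a ** (inv\<^bsub>matrix_group\<^esub> a ** p) = p"
    using a p by (simp_all add: G.inv_solve_left' matrix_mul_assoc)
qed simp_all

text \<open>Tangent vectors have second row 0, so left multiplication by \<open>a\<close> scales
  both of their components, and the coordinate y of the base point, by the first entry of
  \<open>a\<close>. The symbols are quadratic in the components and of degree -1 in y, hence scale
  by the same factor. The metric, of degrees 2 and -2, is invariant for this reason too.\<close>

lemma \<Gamma>_left_translation:
  assumes "a \<in> carrier matrix_group" "p \<in> carrier matrix_group"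
    "u \<in> tangent (carrier matrix_group)" "v \<in> tangent (carrier matrix_group)"
  shows "matrix.\<Gamma> \<alpha> (a ** p) (a ** u) (a ** v) = a ** matrix.\<Gamma> \<alpha> p u v"
  using assms
  by (simp add: alpha_christoffel_def matrix_2_eq_iff matrix_mult_nth_2 tangent_matrix_group_nth
      mem_matrix_group_iff) (simp add: field_simps)

lemma left_invariant_metric: "left_invariant_metric matrix_group matrix_metric"
  unfolding left_invariant_metric_def metric_preserving_def matrix_group_simps
proof (intro ballI)
  fix a p u v
  assume a: "a \<in> carrier matrix_group" and p: "p \<in> carrier matrix_group"
    and u: "u \<in> tangent (carrier matrix_group)" and v: "v \<in> tangent (carrier matrix_group)"
  show "matrix_metric (a ** p) (dird ((**) a) p u) (dird ((**) a) p v) = matrix_metric p u v"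
    using a p u v
    by (simp add: affine_isomorphism.dird_\<phi>[OF affine_isomorphism_left_translation[OF a]]
        matrix_metric_def matrix_mult_nth_2 tangent_matrix_group_nth mem_matrix_group_iff)
      (simp add: field_simps power2_eq_square)
qed

lemma left_invariant_connection: "left_invariant_connection matrix_group (matrix_connection \<alpha>)"
  unfolding left_invariant_connection_def connection_preserving_def matrix_connection_eq matrix_group_simps
  by (intro ballI affine_isomorphism.pushforward_christoffel[OF affine_isomorphism_left_translation])
    (simp_all add: \<Gamma>_left_translation)

lemma left_field_eq: "left_field matrix_group v a = (if a \<in> carrier matrix_group then a ** v else 0)"
  by (simp add: left_field_def affine_isomorphism.dird_\<phi>[OF affine_isomorphism_left_translation])

lemma left_invariant_left_field: "left_invariant_field matrix_group (left_field matrix_group v)"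
  unfolding left_invariant_field_def matrix_group_simps
proof (intro ballI ext)
  fix a q assume a: "a \<in> carrier matrix_group"
  interpret a: affine_isomorphism "carrier matrix_group" "carrier matrix_group"
    "(**) a" 0 "(**) a" "(**) (inv\<^bsub>matrix_group\<^esub> a)" 0 "(**) (inv\<^bsub>matrix_group\<^esub> a)"
    by (rule affine_isomorphism_left_translation[OF a])
  show "pushforward ((**) a) (carrier matrix_group) (left_field matrix_group v) q = left_field matrix_group v q"
    using a.\<phi>_\<psi>[of q] a.\<psi>_mem[of q] by (simp add: a.pushforward_eq left_field_eq matrix_mul_assoc)
qed

text \<open>Left multiplication by a group element multiplies \<open>E1\<close> and
  \<open>E2\<close> by its coordinate y, which turns the left-invariant fields into the coordinate
  frame.\<close>

lemma e1_eq: "e1 = matrix.frame_x"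
  by (auto simp: fun_eq_iff e1_def left_field_eq matrix.frame_x_def
      matrix_2_eq_iff matrix_mult_nth_2 mem_matrix_group_iff)

lemma e2_eq: "e2 = matrix.frame_y"
  by (auto simp: fun_eq_iff e2_def left_field_eq matrix.frame_y_def
      matrix_2_eq_iff matrix_mult_nth_2 mem_matrix_group_iff)

section \<open>Smoothness and solvability of the group\<close>

lemma lie_group_matrix_group: "lie_group matrix_group"
  unfolding lie_group_def
proof (intro conjI group_matrix_group affine_domain_matrix_group)
  let ?N = "carrier matrix_group"
  show "smooth_on (?N \<times> ?N) (\<lambda>(a, b). a \<otimes>\<^bsub>matrix_group\<^esub> b)"
    unfolding matrix_group_simps case_prod_beta
    by (intro smooth_on_bilinear[OF tangentially_open_Times[OF matrix.M matrix.M] bounded_bilinear_matrix_mult]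
        smooth_on_linear bounded_linear_fst bounded_linear_snd)
  have x: "smooth_on ?N (\<lambda>A. A $ 1 $ 2 / A $ 1 $ 1)"
    by (rule matrix.smooth_over_cy[OF smooth_on_linear[OF bounded_linear_nth_nth]])
  have y: "smooth_on ?N (\<lambda>A. 1 / A $ 1 $ 1)"
    by (rule matrix.smooth_over_cy[OF smooth_on_const])
  \<comment> \<open>The inverse matrix, with coordinates -x/y and 1/y, written as a constant plus
    smooth functions times fixed matrices.\<close>
  have "smooth_on ?N (\<lambda>A. to_matrix 0 + ((A $ 1 $ 2 / A $ 1 $ 1) *\<^sub>R (- E1) + (1 / A $ 1 $ 1) *\<^sub>R E2))"
    by (intro smooth_on_add[OF matrix.M] smooth_on_scaleR[OF matrix.M] smooth_on_const x y)
  then show "smooth_on ?N (\<lambda>A. inv\<^bsub>matrix_group\<^esub> A)"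
    by (rule smooth_on_transform[OF _ matrix.M]) (simp add: inv_matrix_group matrix_2_eq_iff)
qed

text \<open>The first diagonal entry is multiplicative on the group, so it equals 1 on commutators
  and the derived subgroup lies in the unipotent subgroup \<open>?U\<close>. Its elements act as
  translations of the line and commute, so the second derived subgroup is trivial.\<close>

lemma solvable_matrix_group: "solvable matrix_group"
proof -
  let ?U = "{A \<in> carrier matrix_group. A $ 1 $ 1 = 1}"
  have U: "subgroup ?U matrix_group"
    by (rule G.subgroupI)
      (auto simp: inv_matrix_group mem_matrix_group_iff matrix_mult_nth_2 mat_def intro!: exI[of _ "mat 1"])
  have "derived_set matrix_group (carrier matrix_group) \<subseteq> ?U"
    by (auto simp: inv_matrix_group mem_matrix_group_iff matrix_mult_nth_2)
  then have 1: "derived matrix_group (carrier matrix_group) \<subseteq> ?U"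
    unfolding derived_def by (rule G.generate_subgroup_incl[OF _ U])
  have "derived_set matrix_group ?U \<subseteq> {\<one>\<^bsub>matrix_group\<^esub>}"
    by (auto simp: inv_matrix_group mem_matrix_group_iff matrix_mult_nth_2 matrix_2_eq_iff mat_def)
  then have "derived matrix_group ?U \<subseteq> {\<one>\<^bsub>matrix_group\<^esub>}"
    unfolding derived_def using G.generate_subgroup_incl[OF _ G.triv_subgroup] by simp
  moreover have "derived matrix_group (derived matrix_group (carrier matrix_group)) \<subseteq> derived matrix_group ?U"
    using 1 by (intro G.mono_derived) auto
  moreover have "\<one>\<^bsub>matrix_group\<^esub> \<in> derived matrix_group (derived matrix_group (carrier matrix_group))"
    unfolding derived_def by (rule generate.one)
  ultimately have "(derived matrix_group ^^ 2) (carrier matrix_group) = {\<one>\<^bsub>matrix_group\<^esub>}"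
    by (auto simp: numeral_2_eq_2)
  then show ?thesis
    using group.solvable_iff_trivial_derived_seq[OF group_matrix_group] by blast
qed

lemma statistical_isomorphism_to_matrix:
  "statistical_isomorphism to_matrix half_plane fisher_metric (alpha_connection \<alpha>)
     (carrier matrix_group) matrix_metric (matrix_connection \<alpha>)"
  unfolding statistical_isomorphism_def
proof (intro conjI)
  show "statistical_manifold half_plane fisher_metric (alpha_connection \<alpha>)"
    unfolding alpha_connection_eq by (rule normal.statistical_manifold)
  show "statistical_manifold (carrier matrix_group) matrix_metric (matrix_connection \<alpha>)"
    unfolding matrix_connection_eq by (rule matrix.statistical_manifold)
  show "diffeomorphism to_matrix half_plane (carrier matrix_group)"
    by (rule to_matrix.diffeomorphism)
  show "metric_preserving to_matrix half_plane fisher_metric matrix_metric"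
    by (simp add: metric_preserving_def to_matrix.dird_\<phi> matrix_metric_def fisher_metric_eq)
  show "connection_preserving to_matrix half_plane (alpha_connection \<alpha>) (matrix_connection \<alpha>)"
    unfolding connection_preserving_def alpha_connection_eq matrix_connection_eq
    by (intro ballI to_matrix.pushforward_christoffel \<Gamma>_to_matrix)
qed

theorem proposition4p1p1:
  fixes \<alpha> :: real
  shows "lie_group matrix_group \<and> solvable matrix_group \<and>
    statistical_isomorphism to_matrix
      half_plane fisher_metric (alpha_connection \<alpha>)
      (carrier matrix_group) matrix_metric (matrix_connection \<alpha>) \<and>
    left_invariant_metric matrix_group matrix_metric \<and>
    left_invariant_connection matrix_group (matrix_connection \<alpha>) \<and>
    left_invariant_field matrix_group e1 \<and> left_invariant_field matrix_group e2 \<and>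
    orthonormal_frame (carrier matrix_group) matrix_metric e1 e2 \<and>
    matrix_connection \<alpha> e1 e1 = (\<lambda>A. ((1 - \<alpha>) / sqrt 2) *\<^sub>R e2 A) \<and>
    matrix_connection \<alpha> e1 e2 = (\<lambda>A. (- ((1 + \<alpha>) / sqrt 2)) *\<^sub>R e1 A) \<and>
    matrix_connection \<alpha> e2 e1 = (\<lambda>A. (- (\<alpha> / sqrt 2)) *\<^sub>R e1 A) \<and>
    matrix_connection \<alpha> e2 e2 = (\<lambda>A. (- (2 * \<alpha> / sqrt 2)) *\<^sub>R e2 A) \<and>
    skewness_operator (carrier matrix_group) matrix_metric (matrix_connection 1) e1 e1
      = (\<lambda>A. sqrt 2 *\<^sub>R e2 A) \<and>
    skewness_operator (carrier matrix_group) matrix_metric (matrix_connection 1) e1 e2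
      = (\<lambda>A. sqrt 2 *\<^sub>R e1 A) \<and>
    skewness_operator (carrier matrix_group) matrix_metric (matrix_connection 1) e2 e2
      = (\<lambda>A. (2 * sqrt 2) *\<^sub>R e2 A)"
proof -
  have "left_invariant_field matrix_group e1" "left_invariant_field matrix_group e2"
    unfolding e1_def e2_def by (rule left_invariant_left_field)+
  \<comment> \<open>These facts concern the coordinate frame and the explicit connection; reading
    the identification lemmas from right to left restates them for \<open>e1\<close>,
    \<open>e2\<close> and the transported connection.\<close>
  moreover note matrix.orthonormal_frame matrix.nabla_frame[of \<alpha>] matrix.skewness_frame
  ultimately show ?thesis
    unfolding e1_eq[symmetric] e2_eq[symmetric] matrix_connection_eq[symmetric]
    by (intro conjI lie_group_matrix_group solvable_matrix_group statistical_isomorphism_to_matrix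
        left_invariant_metric left_invariant_connection)
qed

end
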